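(* Let $\Omega$ be finite, $\ell \ge 2$, and $\mathcal{P}$ a distribution on $\Omega^\ell$ with $\rho(\mathcal{P}) \le \rho < 1$ (marginals not necessarily equal), and let $\epsilon \in [0,1)$. For $n \in \mathbb{N}$ let $\overline{X}_i$, $i \in [n]$, be i.i.d. according to $\mathcal{P}$ and $\underline{X}^{(j)} = (X_1^{(j)},\ldots,X_n^{(j)})$. Then for all $\mu^{(1)},\ldots,\mu^{(\ell)} \in (0,1]$ there exist $k = k(\mathcal{P},\epsilon,\mu^{(1)},\ldots,\mu^{(\ell)}) \in \mathbb{N}$ and $c(\mathcal{P},\epsilon,\mu^{(1)},\ldots,\mu^{(\ell)}) > 0$ such that for all $n$ and all functions $f^{(1)},\ldots,f^{(\ell)}: \Omega^n \to [0,1]$ with $\mathbb{E}[f^{(j)}(\underline{X}^{(j)})] = \mu^{(j)}$ such that each $f^{(j)}$ is $\epsilon$-resilient up to size $k$, \[ \mathbb{E}\Big[\prod_{j=1}^\ell f^{(j)}(\underline{X}^{(j)})\Big] \ge c(\mathcal{P},\epsilon,\mu^{(1)},\ldots,\mu^{(\ell)}) > 0. \]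
   Context: Let $\pi^{(j)}$ be the $j$-th marginal of $\mathcal{P}$. A restriction is $\mathcal{R} = (r_1,\ldots,r_n)$ with $r_i \in \Omega \cup \{\star\}$, of size $|\{i: r_i \ne \star\}|$, acting by $(\mathcal{R}f)(x) := f(y)$ with $y_i = r_i$ if $r_i \ne \star$, else $y_i = x_i$. $f^{(j)}$ is $\epsilon$-resilient up to size $k$ if for all restrictions $\mathcal{R}$ of size at most $k$ (with restricted values in $\mathrm{supp}(\pi^{(j)})$), $(1-\epsilon)\mathbb{E}[f^{(j)}(\underline{X}^{(j)})] \le \mathbb{E}[\mathcal{R}f^{(j)}(\underline{X}^{(j)})] \le (1+\epsilon)\mathbb{E}[f^{(j)}(\underline{X}^{(j)})]$. Correlation: $\rho(\mathcal{P},S,T) := \sup\{\mathrm{Cov}[f(X^{(S)}), g(X^{(T)})] : \mathrm{Var}[f(X^{(S)})]=\mathrm{Var}[g(X^{(T)})]=1\}$ and $\rho(\mathcal{P}) := \max_j \rho(\mathcal{P},\{j\},[\ell]\setminus\{j\})$. *)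

theory Defs
  imports "HOL-Probability.Probability"
begin

text \<open>
  The finite alphabet \<open>\<Omega>\<close> is a type \<open>'a::finite\<close>, the index set \<open>[\<ell>]\<close> is a type \<open>'l::finite\<close>, and
  a distribution on \<open>\<Omega>\<^sup>\<ell>\<close> is a \<open>('l \<Rightarrow> 'a) pmf\<close>. As \<open>n\<close> is quantified inside the theorem,
  \<open>\<Omega>\<^sup>n\<close> is rendered as \<open>{..<n} \<rightarrow>\<^sub>E UNIV\<close>, the extensional functions on \<open>{..<n}\<close>.
\<close>

definition marginal :: "('l \<Rightarrow> 'a) pmf \<Rightarrow> 'l \<Rightarrow> 'a pmf" where
  "marginal P j = map_pmf (\<lambda>x. x j) P"

definition covariance :: "'b pmf \<Rightarrow> ('b \<Rightarrow> real) \<Rightarrow> ('b \<Rightarrow> real) \<Rightarrow> real" where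
  "covariance P F G =
     measure_pmf.expectation P
       (\<lambda>x. (F x - measure_pmf.expectation P F) * (G x - measure_pmf.expectation P G))"

text \<open>
  The tuple \<open>X\<^sup>(\<^sup>S\<^sup>)\<close> is \<open>restrict x S\<close>. The supremum is taken in the extended reals because no
  admissible pair \<open>(f, g)\<close> exists if \<open>X\<^sup>(\<^sup>S\<^sup>)\<close> or \<open>X\<^sup>(\<^sup>T\<^sup>)\<close> is almost surely constant; it is then
  \<open>-\<infinity>\<close>, whereas the supremum of the empty set of reals is unspecified.
\<close>

definition correlation :: "('l \<Rightarrow> 'a) pmf \<Rightarrow> 'l set \<Rightarrow> 'l set \<Rightarrow> ereal" where
  "correlation P S T =
     Sup {ereal (covariance P (\<lambda>x. f (restrict x S)) (\<lambda>x. g (restrict x T))) | f g.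
            measure_pmf.variance P (\<lambda>x. f (restrict x S)) = 1 \<and>
            measure_pmf.variance P (\<lambda>x. g (restrict x T)) = 1}"

definition max_correlation :: "('l::finite \<Rightarrow> 'a) pmf \<Rightarrow> ereal" where
  "max_correlation P = (MAX j. correlation P {j} (UNIV - {j}))"

text \<open>
  The joint law of the i.i.d. tuples \<open>X 0, \<dots>, X (n - 1)\<close>, with \<open>X i :: 'l \<Rightarrow> 'a\<close>. The value
  \<open>undefined\<close> is only the default that \<open>Pi_pmf\<close> assigns to the indices outside \<open>{..<n}\<close>.
\<close>

definition iid_law :: "nat \<Rightarrow> ('l \<Rightarrow> 'a) pmf \<Rightarrow> (nat \<Rightarrow> 'l \<Rightarrow> 'a) pmf" where
  "iid_law n P = Pi_pmf {..<n} undefined (\<lambda>_. P)"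

definition marginal_seq :: "nat \<Rightarrow> 'l \<Rightarrow> (nat \<Rightarrow> 'l \<Rightarrow> 'a) \<Rightarrow> (nat \<Rightarrow> 'a)" where
  "marginal_seq n j X = (\<lambda>i\<in>{..<n}. X i j)"

text \<open>
  A restriction is a partial map \<open>R :: nat \<rightharpoonup> 'a\<close> with \<open>dom R \<subseteq> {..<n}\<close>: here \<open>None\<close> plays
  the role of \<open>\<star>\<close>, and the size of \<open>R\<close> is \<open>card (dom R)\<close>.
\<close>

definition apply_restriction ::
  "nat \<Rightarrow> (nat \<rightharpoonup> 'a) \<Rightarrow> ((nat \<Rightarrow> 'a) \<Rightarrow> real) \<Rightarrow> (nat \<Rightarrow> 'a) \<Rightarrow> real" where
  "apply_restriction n R f x =
     f (\<lambda>i\<in>{..<n}. case R i of Some r \<Rightarrow> r | None \<Rightarrow> x i)"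

definition resilient ::
  "('l \<Rightarrow> 'a) pmf \<Rightarrow> nat \<Rightarrow> 'l \<Rightarrow> real \<Rightarrow> nat \<Rightarrow> ((nat \<Rightarrow> 'a) \<Rightarrow> real) \<Rightarrow> bool" where
  "resilient P n j \<epsilon> k f \<longleftrightarrow>
     (\<forall>R. dom R \<subseteq> {..<n} \<and> ran R \<subseteq> set_pmf (marginal P j) \<and> card (dom R) \<le> k \<longrightarrow>
        (let m = measure_pmf.expectation (iid_law n P) (\<lambda>X. f (marginal_seq n j X));
             m' = measure_pmf.expectation (iid_law n P) (\<lambda>X. apply_restriction n R f (marginal_seq n j X))
         in (1 - \<epsilon>) * m \<le> m' \<and> m' \<le> (1 + \<epsilon>) * m))"

end

theory Submission
  imports Defs
begin

text \<open>
  Write \<open>\<delta>\<close> for a constant with \<open>Var (\<Sum>j. V j) \<ge> \<delta> * (\<Sum>j. Var (V j))\<close> whenever \<open>V j\<close> depends on the \<open>j\<close>-th entry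
  only; \<open>\<rho> < 1\<close> provides one. If \<open>K * \<delta>\<close> is large, then \<open>\<Phi> x = (\<Prod>j. x j ^ K)\<close> is convex enough along such
  increments \<open>V\<close> to satisfy \<open>E (\<Phi> (x + V)) \<ge> \<Phi> x\<close> up to an error of third order in \<open>V\<close>. Revealing
  the coordinates one at a time gives, for functions \<open>g j\<close> with values in \<open>[0,1]\<close>,
  \<open>E (\<Prod>j. g j) \<ge> E (\<Phi> g) \<ge> (\<Prod>j. (E (g j)) ^ K)\<close> up to the third moments of the martingale differences.

  These third moments are small if \<open>g j\<close> is a noisy version of \<open>f j\<close> whose influences are small: the
  squares of the differences sum to at most \<open>1\<close>, and hypercontractivity makes large differences
  rare. Replacing \<open>f j\<close> by \<open>g j\<close> costs little because \<open>\<rho> < 1\<close> damps the high-degree part of \<open>f j\<close>.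
  Finally, small influences are reached by restricting boundedly many coordinates, since each
  restriction of an influential coordinate raises the noise stability. Resilience keeps the means of
  the restricted functions above \<open>(1 - \<epsilon>) * \<mu> j\<close>, and a fixed restriction of bounded size occurs with
  probability bounded below.
\<close>

subsection \<open>Expectations over a finite type\<close>

text \<open>A finite sum, so that linearity and the interchange of two means need no integrability
  conditions.\<close>

definition mean :: "'b::finite pmf \<Rightarrow> ('b \<Rightarrow> real) \<Rightarrow> real" where
  "mean p f = (\<Sum>x\<in>UNIV. pmf p x * f x)"

lemma mean_eq_expectation: "mean p f = measure_pmf.expectation p f"
  unfolding mean_def by (subst integral_measure_pmf_real[of UNIV]) (auto simp: mult.commute)

lemma mean_const [simp]: "mean p (\<lambda>_. c) = c"
  by (simp add: mean_def sum_pmf_eq_1 flip: sum_distrib_right)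

lemma mean_add: "mean p (\<lambda>x. f x + g x) = mean p f + mean p g"
  by (simp add: mean_def distrib_left sum.distrib)

lemma mean_diff: "mean p (\<lambda>x. f x - g x) = mean p f - mean p g"
  by (simp add: mean_def right_diff_distrib sum_subtractf)

lemma mean_cmult: "mean p (\<lambda>x. c * f x) = c * mean p f"
  by (simp add: mean_def sum_distrib_left mult.left_commute)

lemma mean_multc: "mean p (\<lambda>x. f x * c) = mean p f * c"
  using mean_cmult[of p c f] by (simp add: mult.commute)

lemma mean_sum: "mean p (\<lambda>x. \<Sum>i\<in>I. f i x) = (\<Sum>i\<in>I. mean p (f i))"
  unfolding mean_def sum_distrib_left by (rule sum.swap)

lemma mean_swap: "mean p (\<lambda>x. mean q (f x)) = mean q (\<lambda>y. mean p (\<lambda>x. f x y))"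
  unfolding mean_def sum_distrib_left by (subst sum.swap) (simp add: mult_ac)

lemma mean_cong: "(\<And>x. x \<in> set_pmf p \<Longrightarrow> f x = g x) \<Longrightarrow> mean p f = mean p g"
  unfolding mean_def by (rule sum.cong) (auto simp: set_pmf_iff)

lemma mean_mono: "(\<And>x. x \<in> set_pmf p \<Longrightarrow> f x \<le> g x) \<Longrightarrow> mean p f \<le> mean p g"
  unfolding mean_def by (rule sum_mono) (metis mult_left_mono pmf_nonneg set_pmf_iff mult_zero_left order_refl)

lemma mean_nonneg: "(\<And>x. x \<in> set_pmf p \<Longrightarrow> 0 \<le> f x) \<Longrightarrow> 0 \<le> mean p f"
  using mean_mono[of p "\<lambda>_. 0" f] by simp

lemma mean_map: "mean (map_pmf h p) f = mean p (\<lambda>x. f (h x))"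
  by (simp add: mean_eq_expectation)

lemma mean_return [simp]: "mean (return_pmf a) f = f a"
  by (simp add: mean_eq_expectation)

lemma mean_ge_atom:
  assumes "\<And>x. x \<in> set_pmf p \<Longrightarrow> 0 \<le> f x"
  shows "pmf p a * f a \<le> mean p f"
  unfolding mean_def
  by (rule member_le_sum) (use assms in \<open>auto simp: set_pmf_iff zero_le_mult_iff\<close>)

text \<open>Serves to pick a value for a restricted coordinate at which a potential is at least its
  average.\<close>

lemma mean_attained: "\<exists>a\<in>set_pmf p. mean p f \<le> f a"
proof (rule ccontr)
  assume "\<not> ?thesis"
  then have less: "f a < mean p f" if "a \<in> set_pmf p" for a
    using that by force
  obtain a where a: "a \<in> set_pmf p"
    using set_pmf_not_empty[of p] by blast
  have "pmf p a * (mean p f - f a) \<le> mean p (\<lambda>x. mean p f - f x)"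
    by (rule mean_ge_atom) (use less in force)
  moreover have "0 < pmf p a * (mean p f - f a)"
    using less[OF a] a by (simp add: pmf_positive)
  ultimately show False
    by (simp add: mean_diff)
qed

subsection \<open>Expectations under product measures\<close>

text \<open>The factors form a list and may differ, because a restricted coordinate will have a
  point mass as its law. The recursion makes every later induction peel off the first
  coordinate.\<close>

primrec pmean :: "'b::finite pmf list \<Rightarrow> ('b list \<Rightarrow> real) \<Rightarrow> real" where
  "pmean [] f = f []"
| "pmean (p # ps) f = mean p (\<lambda>x. pmean ps (\<lambda>xs. f (x # xs)))"

lemma pmean_const [simp]: "pmean ps (\<lambda>_. c) = c"
  by (induction ps) auto

lemma pmean_add: "pmean ps (\<lambda>x. f x + g x) = pmean ps f + pmean ps g"
  by (induction ps arbitrary: f g) (auto simp: mean_add)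

lemma pmean_diff: "pmean ps (\<lambda>x. f x - g x) = pmean ps f - pmean ps g"
  by (induction ps arbitrary: f g) (auto simp: mean_diff)

lemma pmean_cmult: "pmean ps (\<lambda>x. c * f x) = c * pmean ps f"
  by (induction ps arbitrary: f) (auto simp: mean_cmult)

lemma pmean_mono_length: "(\<And>xs. length xs = length ps \<Longrightarrow> f xs \<le> g xs) \<Longrightarrow> pmean ps f \<le> pmean ps g"
  by (induction ps arbitrary: f g) (auto intro!: mean_mono)

lemma pmean_mono: "(\<And>xs. f xs \<le> g xs) \<Longrightarrow> pmean ps f \<le> pmean ps g"
  by (rule pmean_mono_length)

lemma pmean_cong_length: "(\<And>xs. length xs = length ps \<Longrightarrow> f xs = g xs) \<Longrightarrow> pmean ps f = pmean ps g"
  by (intro antisym pmean_mono_length) auto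

lemma pmean_nonneg: "(\<And>xs. 0 \<le> f xs) \<Longrightarrow> 0 \<le> pmean ps f"
  using pmean_mono[of "\<lambda>_. 0" f] by simp

lemma pmean_mean: "pmean ps (\<lambda>xs. mean p (\<lambda>x. f x xs)) = mean p (\<lambda>x. pmean ps (f x))"
  by (induction ps arbitrary: f) (auto simp: mean_swap[of p])

lemma pmean_map: "pmean (map (map_pmf h) ps) f = pmean ps (\<lambda>xs. f (map h xs))"
  by (induction ps arbitrary: f) (auto simp: mean_map)

lemma pmean_snoc: "pmean (ps @ [p]) f = pmean ps (\<lambda>xs. mean p (\<lambda>x. f (xs @ [x])))"
  by (induction ps arbitrary: f) auto

text \<open>The quadratic form \<open>pmean ps (\<lambda>x. (a * f x - b * g x)\<^sup>2)\<close> is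
  nonnegative; \<open>a = B\<close>, \<open>b = A\<close> gives the claim unless
  \<open>B = 0\<close>.\<close>

lemma pmean_Cauchy_Schwarz: "(pmean ps (\<lambda>x. f x * g x))\<^sup>2 \<le> pmean ps (\<lambda>x. (f x)\<^sup>2) * pmean ps (\<lambda>x. (g x)\<^sup>2)"
proof -
  define A B F where "A = pmean ps (\<lambda>x. f x * g x)" and "B = pmean ps (\<lambda>x. (g x)\<^sup>2)"
    and "F = pmean ps (\<lambda>x. (f x)\<^sup>2)"
  have sq: "0 \<le> a\<^sup>2 * F - 2 * a * b * A + b\<^sup>2 * B" for a b
  proof -
    have "0 \<le> pmean ps (\<lambda>x. (a * f x - b * g x)\<^sup>2)"
      by (rule pmean_nonneg) simp
    also have "(\<lambda>x. (a * f x - b * g x)\<^sup>2) =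
        (\<lambda>x. a\<^sup>2 * (f x)\<^sup>2 - (2 * a * b) * (f x * g x) + b\<^sup>2 * (g x)\<^sup>2)"
      by (auto simp: power2_eq_square algebra_simps)
    finally show ?thesis
      by (simp only: pmean_add pmean_diff pmean_cmult A_def B_def F_def)
  qed
  have "0 \<le> B"
    unfolding B_def by (rule pmean_nonneg) simp
  show ?thesis
  proof (cases "B = 0")
    case True
    have "A = 0"
    proof (rule ccontr)
      assume "A \<noteq> 0"
      \<comment> \<open>At this point the form would equal \<open>F - (F + 1) = - 1\<close>.\<close>
      have "0 \<le> F - 2 * ((F + 1) / (2 * A)) * A"
        using sq[of 1 "(F + 1) / (2 * A)"] True by simp
      then show False
        using \<open>A \<noteq> 0\<close> by simp
    qed
    then show ?thesis
      using True unfolding A_def B_def by simp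
  next
    case False
    then have "0 < B"
      using \<open>0 \<le> B\<close> by simp
    have "0 \<le> B * (F * B - A\<^sup>2)"
      using sq[of B A] by (simp add: power2_eq_square algebra_simps)
    then have "A\<^sup>2 \<le> F * B"
      using \<open>0 < B\<close> by (simp add: zero_le_mult_iff)
    then show ?thesis
      unfolding A_def B_def F_def .
  qed
qed

lemma mean_Cauchy_Schwarz: "(mean p (\<lambda>x. f x * g x))\<^sup>2 \<le> mean p (\<lambda>x. (f x)\<^sup>2) * mean p (\<lambda>x. (g x)\<^sup>2)"
  using pmean_Cauchy_Schwarz[of "[p]" "\<lambda>xs. f (hd xs)" "\<lambda>xs. g (hd xs)"] by simp

subsection \<open>Noise operators\<close>

text \<open>One step of the Efron--Stein decomposition: \<open>f (x # zs)\<close> is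
  \<open>avg p f zs + dev p f x zs\<close>, and the summands are orthogonal since the second has
  mean \<open>0\<close> in \<open>x\<close>.\<close>

definition avg :: "'b::finite pmf \<Rightarrow> ('b list \<Rightarrow> real) \<Rightarrow> 'b list \<Rightarrow> real" where
  "avg p f zs = mean p (\<lambda>z. f (z # zs))"

definition dev :: "'b::finite pmf \<Rightarrow> ('b list \<Rightarrow> real) \<Rightarrow> 'b \<Rightarrow> 'b list \<Rightarrow> real" where
  "dev p f x zs = f (x # zs) - avg p f zs"

lemma mean_dev [simp]: "mean p (\<lambda>x. dev p f x zs) = 0"
  by (simp add: dev_def avg_def mean_diff)

lemma pmean_avg: "pmean ps (avg p f) = pmean (p # ps) f"
  by (simp add: avg_def[abs_def] pmean_mean)

lemma pmean_dev: "pmean ps (dev p f x) = pmean ps (\<lambda>zs. f (x # zs)) - pmean (p # ps) f"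
  by (simp add: dev_def[abs_def] pmean_diff pmean_avg)

text \<open>For fixed \<open>zs\<close> the cross terms are linear in \<open>B\<close> or in
  \<open>D\<close> and average to \<open>0\<close> over \<open>x\<close>. This orthogonality drives
  the inductions on noise, stability and influence.\<close>

lemma mean_pmean_orthogonal:
  assumes "\<And>zs. mean p (\<lambda>x. B x zs) = 0" "\<And>zs. mean p (\<lambda>x. D x zs) = 0"
  shows "mean p (\<lambda>x. pmean ps (\<lambda>zs. (A zs + B x zs) * (C zs + D x zs))) =
    pmean ps (\<lambda>zs. A zs * C zs) + mean p (\<lambda>x. pmean ps (\<lambda>zs. B x zs * D x zs))"
proof -
  have "mean p (\<lambda>x. (A zs + B x zs) * (C zs + D x zs)) =
      A zs * C zs + mean p (\<lambda>x. B x zs * D x zs)" for zs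
  proof -
    have "(\<lambda>x. (A zs + B x zs) * (C zs + D x zs)) =
        (\<lambda>x. A zs * C zs + (A zs * D x zs + C zs * B x zs + B x zs * D x zs))"
      by (auto simp: algebra_simps)
    then show ?thesis
      by (simp add: mean_add mean_cmult assms)
  qed
  then show ?thesis
    by (simp add: pmean_add flip: pmean_mean)
qed

text \<open>
  In terms of the Efron--Stein decomposition \<open>f = (\<Sum>S. f S)\<close>, \<open>noise ps t f\<close> is \<open>\<Sum>S. (\<Prod>i\<in>S. t i) * f S\<close> and
  \<open>stab ps t f\<close> is \<open>\<Sum>S. (\<Prod>i\<in>S. t i) * \<parallel>f S\<parallel>\<^sup>2\<close>. Peeling off the first coordinate into its average and
  the deviation from it makes the decomposition itself unnecessary. A rate of \<open>0\<close> averages a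
  coordinate out, a rate of \<open>1\<close> leaves it alone.
\<close>

primrec noise :: "'b::finite pmf list \<Rightarrow> (nat \<Rightarrow> real) \<Rightarrow> ('b list \<Rightarrow> real) \<Rightarrow> 'b list \<Rightarrow> real" where
  "noise [] t f xs = f xs"
| "noise (p # ps) t f xs = noise ps (\<lambda>k. t (Suc k)) (avg p f) (tl xs) +
     t 0 * noise ps (\<lambda>k. t (Suc k)) (dev p f (hd xs)) (tl xs)"

primrec stab :: "'b::finite pmf list \<Rightarrow> (nat \<Rightarrow> real) \<Rightarrow> ('b list \<Rightarrow> real) \<Rightarrow> real" where
  "stab [] t f = (f [])\<^sup>2"
| "stab (p # ps) t f = stab ps (\<lambda>k. t (Suc k)) (avg p f) +
     t 0 * mean p (\<lambda>x. stab ps (\<lambda>k. t (Suc k)) (dev p f x))"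

section \<open>Linearity of averages, deviations and noise\<close>

lemma avg_add: "avg p (\<lambda>x. f x + g x) = (\<lambda>x. avg p f x + avg p g x)"
  by (auto simp: avg_def mean_add)

lemma avg_cmult: "avg p (\<lambda>x. c * f x) = (\<lambda>x. c * avg p f x)"
  by (auto simp: avg_def mean_cmult)

lemma dev_add: "dev p (\<lambda>x. f x + g x) y = (\<lambda>x. dev p f y x + dev p g y x)"
  by (auto simp: dev_def avg_add)

lemma dev_cmult: "dev p (\<lambda>x. c * f x) y = (\<lambda>x. c * dev p f y x)"
  by (auto simp: dev_def avg_cmult algebra_simps)

lemma noise_add: "noise ps t (\<lambda>x. f x + g x) xs = noise ps t f xs + noise ps t g xs"
  by (induction ps arbitrary: f g t xs) (auto simp: avg_add dev_add algebra_simps)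

lemma noise_cmult: "noise ps t (\<lambda>x. c * f x) xs = c * noise ps t f xs"
  by (induction ps arbitrary: f t xs) (auto simp: avg_cmult dev_cmult algebra_simps)

lemma noise_diff: "noise ps t (\<lambda>x. f x - g x) xs = noise ps t f xs - noise ps t g xs"
  using noise_add[of ps t f "\<lambda>x. - 1 * g x" xs] noise_cmult[of ps t "- 1" g xs] by simp

lemma noise_zero [simp]: "noise ps t (\<lambda>_. 0) xs = 0"
  using noise_cmult[of ps t 0 "\<lambda>_. 0" xs] by simp

lemma noise_sum: "noise ps t (\<lambda>x. \<Sum>i\<in>I. f i x) xs = (\<Sum>i\<in>I. noise ps t (f i) xs)"
  by (induction I rule: infinite_finite_induct) (auto simp: noise_add)

lemma noise_mean: "noise ps t (\<lambda>x. mean p (\<lambda>z. f z x)) xs = mean p (\<lambda>z. noise ps t (f z) xs)"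
  unfolding mean_def by (simp add: noise_sum noise_cmult)

lemma mean_noise_dev [simp]: "mean p (\<lambda>x. noise ps t (dev p f x) xs) = 0"
  by (simp flip: noise_mean)

text \<open>The probabilistic reading: the first coordinate is kept with weight \<open>t 0\<close>
  and resampled with weight \<open>1 - t 0\<close>. For rates in \<open>[0,1]\<close> this is a
  convex combination, so bounds on the values survive.\<close>

lemma noise_Cons:
  "noise (p # ps) t f (x # xs) = t 0 * noise ps (\<lambda>k. t (Suc k)) (\<lambda>zs. f (x # zs)) xs +
     (1 - t 0) * mean p (\<lambda>z. noise ps (\<lambda>k. t (Suc k)) (\<lambda>zs. f (z # zs)) xs)"
  by (simp add: dev_def[abs_def] noise_diff avg_def[abs_def] noise_mean algebra_simps)

section \<open>Composition, range and self-adjointness of noise\<close>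

lemma avg_noise: "avg p (noise (p # ps) t f) = noise ps (\<lambda>k. t (Suc k)) (avg p f)"
  by (rule ext) (simp add: avg_def[of p "noise _ _ _"] mean_add mean_cmult)

lemma dev_noise: "dev p (noise (p # ps) t f) x = (\<lambda>xs. t 0 * noise ps (\<lambda>k. t (Suc k)) (dev p f x) xs)"
  by (rule ext) (simp add: dev_def[of p "noise _ _ _"] avg_noise del: noise.simps, simp)

text \<open>Noise multiplies the component of \<open>S\<close> by the product of the rates over
  \<open>S\<close>, and multipliers compose by multiplication.\<close>

lemma noise_noise: "noise ps t (noise ps s f) = noise ps (\<lambda>k. t k * s k) f"
proof (induction ps arbitrary: t s f)
  case (Cons p ps)
  show ?case
    by (rule ext, subst noise.simps(2)[of p ps t])
      (simp add: avg_noise dev_noise noise_cmult Cons del: noise.simps, simp)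
qed (auto simp: fun_eq_iff)

lemma noise_range:
  assumes "\<And>k. 0 \<le> t k \<and> t k \<le> 1" "\<And>xs. 0 \<le> f xs \<and> f xs \<le> 1"
  shows "length xs = length ps \<Longrightarrow> 0 \<le> noise ps t f xs \<and> noise ps t f xs \<le> 1"
  using assms
proof (induction ps arbitrary: t f xs)
  case (Cons p ps)
  then obtain x ys where xs: "xs = x # ys" "length ys = length ps"
    by (metis length_Suc_conv)
  have *: "0 \<le> noise ps (\<lambda>k. t (Suc k)) (\<lambda>zs. f (z # zs)) ys"
    "noise ps (\<lambda>k. t (Suc k)) (\<lambda>zs. f (z # zs)) ys \<le> 1" for z
    using Cons.IH[OF xs(2), of "\<lambda>k. t (Suc k)" "\<lambda>zs. f (z # zs)"] Cons.prems by auto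
  have "0 \<le> mean p (\<lambda>z. noise ps (\<lambda>k. t (Suc k)) (\<lambda>zs. f (z # zs)) ys)"
    "mean p (\<lambda>z. noise ps (\<lambda>k. t (Suc k)) (\<lambda>zs. f (z # zs)) ys) \<le> 1"
    using mean_nonneg[of p] mean_mono[of p _ "\<lambda>_. 1"] * by auto
  with * Cons.prems(2)[of 0] show ?case
    unfolding xs noise_Cons by (auto intro!: convex_bound_le)
qed auto

lemma pmean_noise: "pmean ps (noise ps t f) = pmean ps f"
proof (induction ps arbitrary: t f)
  case (Cons p ps)
  show ?case
    by (simp only: avg_noise Cons flip: pmean_avg)
qed auto

lemma noise_zero_rate: "length xs = length ps \<Longrightarrow> noise ps (\<lambda>_. 0) f xs = pmean ps f"
  by (induction ps arbitrary: f xs) (auto simp: pmean_avg)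

text \<open>Self-adjointness: noise preserves the orthogonal splitting into \<open>avg\<close> and
  \<open>dev\<close> and scales the deviation by the real number \<open>t 0\<close>.\<close>

lemma pmean_noise_mult: "pmean ps (\<lambda>xs. noise ps t f xs * g xs) = pmean ps (\<lambda>xs. f xs * noise ps t g xs)"
proof (induction ps arbitrary: t f g)
  case (Cons p ps)
  let ?N = "noise ps (\<lambda>k. t (Suc k))"
  have "pmean (p # ps) (\<lambda>xs. noise (p # ps) t f xs * g xs) =
      mean p (\<lambda>x. pmean ps (\<lambda>zs. (?N (avg p f) zs + t 0 * ?N (dev p f x) zs) * (avg p g zs + dev p g x zs)))"
    by (simp add: dev_def)
  also have "\<dots> = pmean ps (\<lambda>zs. ?N (avg p f) zs * avg p g zs) + t 0 * mean p (\<lambda>x. pmean ps (\<lambda>zs. ?N (dev p f x) zs * dev p g x zs))"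
    by (subst mean_pmean_orthogonal) (auto simp: mean_cmult mult.assoc pmean_cmult)
  also have "\<dots> = pmean ps (\<lambda>zs. avg p f zs * ?N (avg p g) zs) + t 0 * mean p (\<lambda>x. pmean ps (\<lambda>zs. dev p f x zs * ?N (dev p g x) zs))"
    by (simp add: Cons)
  also have "\<dots> = mean p (\<lambda>x. pmean ps (\<lambda>zs. (avg p f zs + dev p f x zs) * (?N (avg p g) zs + t 0 * ?N (dev p g x) zs)))"
    by (subst mean_pmean_orthogonal) (auto simp: mean_cmult mult.left_commute pmean_cmult)
  also have "\<dots> = pmean (p # ps) (\<lambda>xs. f xs * noise (p # ps) t g xs)"
    by (simp add: dev_def)
  finally show ?case .
qed auto

section \<open>Noise stability as a quadratic form\<close>

lemma stab_eq: "stab ps t f = pmean ps (\<lambda>xs. f xs * noise ps t f xs)"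
proof (induction ps arbitrary: t f)
  case (Cons p ps)
  let ?N = "noise ps (\<lambda>k. t (Suc k))"
  have "pmean (p # ps) (\<lambda>xs. f xs * noise (p # ps) t f xs) =
      mean p (\<lambda>x. pmean ps (\<lambda>zs. (avg p f zs + dev p f x zs) * (?N (avg p f) zs + t 0 * ?N (dev p f x) zs)))"
    by (simp add: dev_def)
  also have "\<dots> = stab (p # ps) t f"
    by (subst mean_pmean_orthogonal) (auto simp: mean_cmult mult.left_commute pmean_cmult Cons)
  finally show ?case ..
qed (auto simp: power2_eq_square)

lemma pmean_noise_square: "pmean ps (\<lambda>xs. (noise ps t f xs)\<^sup>2) = stab ps (\<lambda>k. (t k)\<^sup>2) f"
  by (simp add: power2_eq_square pmean_noise_mult noise_noise stab_eq)

lemma stab_one: "stab ps (\<lambda>_. 1) f = pmean ps (\<lambda>xs. (f xs)\<^sup>2)"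
proof (induction ps arbitrary: f)
  case (Cons p ps)
  have "pmean (p # ps) (\<lambda>xs. (f xs)\<^sup>2) = mean p (\<lambda>x. pmean ps (\<lambda>zs. (avg p f zs + dev p f x zs) * (avg p f zs + dev p f x zs)))"
    by (simp add: dev_def power2_eq_square)
  then show ?case
    by (simp add: mean_pmean_orthogonal Cons power2_eq_square)
qed auto

lemma stab_mono:
  assumes "\<And>k. 0 \<le> s k \<and> s k \<le> t k"
  shows "0 \<le> stab ps s f \<and> stab ps s f \<le> stab ps t f"
  using assms
proof (induction ps arbitrary: s t f)
  case (Cons p ps)
  have *: "0 \<le> stab ps (\<lambda>k. s (Suc k)) g \<and> stab ps (\<lambda>k. s (Suc k)) g \<le> stab ps (\<lambda>k. t (Suc k)) g" for g
    by (rule Cons.IH) (use Cons.prems in auto)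
  have "0 \<le> mean p (\<lambda>x. stab ps (\<lambda>k. s (Suc k)) (dev p f x))"
    by (rule mean_nonneg) (use * in auto)
  moreover have "mean p (\<lambda>x. stab ps (\<lambda>k. s (Suc k)) (dev p f x)) \<le> mean p (\<lambda>x. stab ps (\<lambda>k. t (Suc k)) (dev p f x))"
    by (rule mean_mono) (use * in auto)
  ultimately show ?case
    using *[of "avg p f"] Cons.prems[of 0] by (auto intro!: add_mono mult_mono)
qed auto

lemma stab_nonneg: "(\<And>k. 0 \<le> t k) \<Longrightarrow> 0 \<le> stab ps t f"
  using stab_mono[of t t] by auto

subsection \<open>Influences\<close>

text \<open>The sum of the Efron--Stein components whose set \<open>S\<close> contains
  \<open>i\<close>, each weighted by the rates over \<open>S - {i}\<close>; \<open>influence\<close>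
  is the sum of their squared norms with the same weights.\<close>

definition ndiff :: "'b::finite pmf list \<Rightarrow> (nat \<Rightarrow> real) \<Rightarrow> nat \<Rightarrow> ('b list \<Rightarrow> real) \<Rightarrow> 'b list \<Rightarrow> real" where
  "ndiff ps t i f xs = noise ps (t(i := 1)) f xs - noise ps (t(i := 0)) f xs"

definition influence :: "'b::finite pmf list \<Rightarrow> (nat \<Rightarrow> real) \<Rightarrow> nat \<Rightarrow> ('b list \<Rightarrow> real) \<Rightarrow> real" where
  "influence ps t i f = stab ps (t(i := 1)) f - stab ps (t(i := 0)) f"

lemma ndiff_Nil: "ndiff [] t i f xs = 0"
  by (simp add: ndiff_def)

lemma ndiff_Cons_0: "ndiff (p # ps) t 0 f xs = noise ps (\<lambda>k. t (Suc k)) (dev p f (hd xs)) (tl xs)"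
  by (simp add: ndiff_def)

lemma ndiff_Cons_Suc: "ndiff (p # ps) t (Suc i) f xs = ndiff ps (\<lambda>k. t (Suc k)) i (avg p f) (tl xs) +
    t 0 * ndiff ps (\<lambda>k. t (Suc k)) i (dev p f (hd xs)) (tl xs)"
  by (simp add: ndiff_def fun_upd_def algebra_simps)

lemma influence_Nil: "influence [] t i f = 0"
  by (simp add: influence_def)

lemma influence_Cons_0: "influence (p # ps) t 0 f = mean p (\<lambda>x. stab ps (\<lambda>k. t (Suc k)) (dev p f x))"
  by (simp add: influence_def)

lemma influence_Cons_Suc: "influence (p # ps) t (Suc i) f = influence ps (\<lambda>k. t (Suc k)) i (avg p f) +
    t 0 * mean p (\<lambda>x. influence ps (\<lambda>k. t (Suc k)) i (dev p f x))"
  by (simp add: influence_def fun_upd_def mean_diff algebra_simps)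

lemma mean_ndiff_dev: "mean p (\<lambda>x. ndiff ps t i (dev p f x) xs) = 0"
  by (simp add: ndiff_def mean_diff)

lemma ndiff_add: "ndiff ps t i (\<lambda>x. f x + g x) xs = ndiff ps t i f xs + ndiff ps t i g xs"
  by (simp add: ndiff_def noise_add)

text \<open>Orthogonality of the components squares each weight, so the rates become their
  squares.\<close>

lemma pmean_ndiff_square: "pmean ps (\<lambda>xs. (ndiff ps t i f xs)\<^sup>2) = influence ps (\<lambda>k. (t k)\<^sup>2) i f"
proof (induction ps arbitrary: t i f)
  case (Cons p ps)
  show ?case
  proof (cases i)
    case 0
    then show ?thesis
      by (simp add: ndiff_Cons_0 influence_Cons_0 pmean_noise_square)
  next
    case (Suc j)
    let ?D = "ndiff ps (\<lambda>k. t (Suc k)) j"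
    have "pmean (p # ps) (\<lambda>xs. (ndiff (p # ps) t i f xs)\<^sup>2) =
        mean p (\<lambda>x. pmean ps (\<lambda>zs. (?D (avg p f) zs + t 0 * ?D (dev p f x) zs) * (?D (avg p f) zs + t 0 * ?D (dev p f x) zs)))"
      by (simp add: Suc ndiff_Cons_Suc power2_eq_square)
    also have "\<dots> = pmean ps (\<lambda>zs. (?D (avg p f) zs)\<^sup>2) + mean p (\<lambda>x. pmean ps (\<lambda>zs. (t 0)\<^sup>2 * (?D (dev p f x) zs)\<^sup>2))"
      by (subst mean_pmean_orthogonal) (auto simp: mean_cmult mean_ndiff_dev power2_eq_square mult_ac)
    finally show ?thesis
      by (simp add: Suc influence_Cons_Suc pmean_cmult mean_cmult Cons)
  qed
qed (auto simp: ndiff_Nil influence_Nil)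

lemma influence_mono:
  assumes "\<And>k. 0 \<le> s k \<and> s k \<le> t k"
  shows "0 \<le> influence ps s i f \<and> influence ps s i f \<le> influence ps t i f"
  using assms
proof (induction ps arbitrary: s t i f)
  case (Cons p ps)
  show ?case
  proof (cases i)
    case 0
    have *: "0 \<le> stab ps (\<lambda>k. s (Suc k)) g \<and> stab ps (\<lambda>k. s (Suc k)) g \<le> stab ps (\<lambda>k. t (Suc k)) g" for g
      by (rule stab_mono) (use Cons.prems in auto)
    show ?thesis
      unfolding 0 influence_Cons_0 using * by (auto intro!: mean_nonneg mean_mono)
  next
    case (Suc j)
    have *: "0 \<le> influence ps (\<lambda>k. s (Suc k)) j g \<and> influence ps (\<lambda>k. s (Suc k)) j g \<le> influence ps (\<lambda>k. t (Suc k)) j g" for g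
      by (rule Cons.IH) (use Cons.prems in auto)
    have "0 \<le> mean p (\<lambda>x. influence ps (\<lambda>k. s (Suc k)) j (dev p f x))"
      by (rule mean_nonneg) (use * in auto)
    moreover have "mean p (\<lambda>x. influence ps (\<lambda>k. s (Suc k)) j (dev p f x)) \<le> mean p (\<lambda>x. influence ps (\<lambda>k. t (Suc k)) j (dev p f x))"
      by (rule mean_mono) (use * in auto)
    ultimately show ?thesis
      unfolding Suc influence_Cons_Suc
      using *[of "avg p f"] Cons.prems[of 0] by (auto intro!: add_mono mult_mono)
  qed
qed (auto simp: influence_Nil)

text \<open>A product of rates is affine in the rate at \<open>i\<close>, with nonzero slope only on
  sets that contain \<open>i\<close>. The same holds for \<open>stab\<close>, with slope
  \<open>influence\<close>.\<close>

lemma noise_upd: "noise ps (t(i := c)) f xs = noise ps (t(i := 0)) f xs + c * ndiff ps t i f xs"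
proof (induction ps arbitrary: t i f xs)
  case (Cons p ps)
  then show ?case
    by (cases i) (auto simp: ndiff_Cons_0 ndiff_Cons_Suc fun_upd_def algebra_simps)
qed (auto simp: ndiff_Nil)

lemma stab_upd: "stab ps (t(i := c)) f = stab ps (t(i := 0)) f + c * influence ps t i f"
proof (induction ps arbitrary: t i f)
  case (Cons p ps)
  then show ?case
    by (cases i) (auto simp: influence_Cons_0 influence_Cons_Suc fun_upd_def mean_add mean_cmult algebra_simps)
qed (auto simp: influence_Nil)

text \<open>Every component that survives in \<open>ndiff\<close> contains \<open>i\<close> and so
  carries the factor \<open>s i\<close>.\<close>

lemma ndiff_noise: "ndiff ps t i (noise ps s f) xs = s i * ndiff ps (\<lambda>k. t k * s k) i f xs"
proof -
  have "(\<lambda>k. (t(i := c)) k * s k) = (\<lambda>k. t k * s k)(i := c * s i)" for c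
    by auto
  then show ?thesis
    unfolding ndiff_def noise_noise by (simp add: noise_upd[of _ _ _ "s i"] ndiff_def)
qed

lemma noise_ndiff: "noise ps s (ndiff ps t i f) xs = ndiff ps t i (noise ps s f) xs"
  unfolding ndiff_def[abs_def] noise_diff noise_noise by (simp add: mult.commute)

subsection \<open>Small-set expansion and a tail bound for noisy functions\<close>

definition min_atom :: "real \<Rightarrow> 'b pmf \<Rightarrow> bool" where
  "min_atom \<alpha> p \<longleftrightarrow> (\<forall>x\<in>set_pmf p. \<alpha> \<le> pmf p x)"

text \<open>The one-coordinate case of 2-to-4 hypercontractivity. The linear term averages to
  \<open>0\<close>, half of a square absorbs the cubic term into the quadratic and quartic ones, and
  the atom bound controls the fourth moment of \<open>v\<close> by its variance.\<close>

lemma fourth_moment_mean: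
  assumes p: "min_atom \<alpha> p" and "0 < \<alpha>" and v: "mean p v = 0" and t: "t\<^sup>2 \<le> \<alpha> / 4"
  shows "mean p (\<lambda>x. (a + t * v x)^4) \<le> (a\<^sup>2 + mean p (\<lambda>x. (v x)\<^sup>2))\<^sup>2"
proof -
  define s where "s = mean p (\<lambda>x. (v x)\<^sup>2)"
  have "0 \<le> s"
    unfolding s_def by (rule mean_nonneg) simp
  have "\<alpha> \<le> 1"
  proof -
    obtain x where "x \<in> set_pmf p"
      using set_pmf_not_empty[of p] by blast
    then show ?thesis
      using p pmf_le_1[of p x] unfolding min_atom_def by force
  qed
  have v2: "\<alpha> * (v x)\<^sup>2 \<le> s" if "x \<in> set_pmf p" for x
  proof -
    have "\<alpha> * (v x)\<^sup>2 \<le> pmf p x * (v x)\<^sup>2"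
      using p that unfolding min_atom_def by (intro mult_right_mono) auto
    also have "\<dots> \<le> s"
      unfolding s_def by (rule mean_ge_atom) simp
    finally show ?thesis .
  qed
  have "mean p (\<lambda>x. \<alpha> * (v x)^4) \<le> mean p (\<lambda>x. s * (v x)\<^sup>2)"
  proof (rule mean_mono)
    fix x assume "x \<in> set_pmf p"
    from mult_right_mono[OF v2[OF this], of "(v x)\<^sup>2"] show "\<alpha> * (v x)^4 \<le> s * (v x)\<^sup>2"
      by (simp add: power2_eq_square power4_eq_xxxx mult_ac)
  qed
  then have v4: "\<alpha> * mean p (\<lambda>x. (v x)^4) \<le> s\<^sup>2"
    by (simp add: mean_cmult s_def power2_eq_square)
  have v4_nonneg: "0 \<le> mean p (\<lambda>x. (v x)^4)"
    by (rule mean_nonneg) simp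
  have t1: "t\<^sup>2 \<le> 1/4"
    using t \<open>\<alpha> \<le> 1\<close> by simp
  have "(a + t * v x)^4 \<le> a^4 + (4 * a^3 * t) * v x + (8 * a\<^sup>2 * t\<^sup>2) * (v x)\<^sup>2 + (3 * t^4) * (v x)^4" for x
  proof -
    \<comment> \<open>The slack in
      \<open>4 * y^3 * a \<le> 2 * y\<^sup>2 * a\<^sup>2 + 2 * y^4\<close> for
      \<open>y = t * v x\<close> is this square.\<close>
    have "a^4 + (4 * a^3 * t) * v x + (8 * a\<^sup>2 * t\<^sup>2) * (v x)\<^sup>2 + (3 * t^4) * (v x)^4 - (a + t * v x)^4
       = 2 * (t * v x * (a - t * v x))\<^sup>2"
      by (simp add: power2_eq_square power4_eq_xxxx power3_eq_cube algebra_simps)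
    then show ?thesis
      by (smt (verit) zero_le_power2)
  qed
  then have "mean p (\<lambda>x. (a + t * v x)^4) \<le> mean p (\<lambda>x. a^4 + (4 * a^3 * t) * v x + (8 * a\<^sup>2 * t\<^sup>2) * (v x)\<^sup>2 + (3 * t^4) * (v x)^4)"
    by (intro mean_mono)
  also have "\<dots> = a^4 + (8 * a\<^sup>2 * t\<^sup>2) * s + (3 * t^4) * mean p (\<lambda>x. (v x)^4)"
    by (simp only: mean_add mean_cmult mean_const v s_def mult_zero_right add_0_right)
  also have "\<dots> \<le> a^4 + 2 * a\<^sup>2 * s + s\<^sup>2"
  proof -
    have "(a\<^sup>2 * s) * (8 * t\<^sup>2) \<le> (a\<^sup>2 * s) * 2"
      using t1 \<open>0 \<le> s\<close> by (intro mult_left_mono) auto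
    moreover have "(3 * t^4) * mean p (\<lambda>x. (v x)^4) \<le> s\<^sup>2"
    proof -
      have "3 * t^4 \<le> \<alpha>"
        using mult_mono[OF t t1] \<open>0 < \<alpha>\<close> by (simp add: power2_eq_square power4_eq_xxxx)
      then have "(3 * t^4) * mean p (\<lambda>x. (v x)^4) \<le> \<alpha> * mean p (\<lambda>x. (v x)^4)"
        using v4_nonneg by (intro mult_right_mono) auto
      with v4 show ?thesis
        by simp
    qed
    ultimately show ?thesis
      by (simp add: mult_ac)
  qed
  also have "\<dots> = (a\<^sup>2 + s)\<^sup>2"
    by (simp add: power2_eq_square power4_eq_xxxx algebra_simps)
  finally show ?thesis
    unfolding s_def .
qed

text \<open>Tensorization: the one-coordinate bound for fixed remaining coordinates leaves products
  of squares of \<open>A\<close> and \<open>B x\<close>, which Cauchy--Schwarz and the induction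
  hypothesis estimate.\<close>

lemma fourth_moment_noise:
  assumes "\<forall>p\<in>set ps. min_atom \<alpha> p" "0 < \<alpha>" "t\<^sup>2 \<le> \<alpha> / 4"
  shows "pmean ps (\<lambda>xs. (noise ps (\<lambda>_. t) f xs)^4) \<le> (pmean ps (\<lambda>xs. (f xs)\<^sup>2))\<^sup>2"
  using assms(1)
proof (induction ps arbitrary: f)
  case (Cons p ps)
  define A where "A = noise ps (\<lambda>_. t) (avg p f)"
  define B where "B x = noise ps (\<lambda>_. t) (dev p f x)" for x
  define a where "a = pmean ps (\<lambda>xs. (avg p f xs)\<^sup>2)"
  define b where "b x = pmean ps (\<lambda>xs. (dev p f x xs)\<^sup>2)" for x
  have nn: "0 \<le> a" "0 \<le> b x" for x
    unfolding a_def b_def by (auto intro: pmean_nonneg)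
  have A4: "pmean ps (\<lambda>xs. (A xs)^4) \<le> a\<^sup>2" and B4: "pmean ps (\<lambda>xs. (B x xs)^4) \<le> (b x)\<^sup>2" for x
    using Cons unfolding A_def B_def a_def b_def by auto
  have CS: "pmean ps (\<lambda>xs. (F xs)\<^sup>2 * (G xs)\<^sup>2) \<le> c * d"
    if "pmean ps (\<lambda>xs. (F xs)^4) \<le> c\<^sup>2" "pmean ps (\<lambda>xs. (G xs)^4) \<le> d\<^sup>2" "0 \<le> c" "0 \<le> d" for F G c d
  proof (rule power2_le_imp_le)
    have "(pmean ps (\<lambda>xs. (F xs)\<^sup>2 * (G xs)\<^sup>2))\<^sup>2 \<le> pmean ps (\<lambda>xs. ((F xs)\<^sup>2)\<^sup>2) * pmean ps (\<lambda>xs. ((G xs)\<^sup>2)\<^sup>2)"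
      by (rule pmean_Cauchy_Schwarz)
    also have "\<dots> \<le> c\<^sup>2 * d\<^sup>2"
      using that by (intro mult_mono) (auto intro: pmean_nonneg)
    finally show "(pmean ps (\<lambda>xs. (F xs)\<^sup>2 * (G xs)\<^sup>2))\<^sup>2 \<le> (c * d)\<^sup>2"
      by (simp add: power_mult_distrib)
  qed (use that in auto)
  have f2: "pmean (p # ps) (\<lambda>xs. (f xs)\<^sup>2) = a + mean p b"
    unfolding a_def b_def by (simp flip: stab_one)
  have "pmean (p # ps) (\<lambda>xs. (noise (p # ps) (\<lambda>_. t) f xs)^4) = pmean ps (\<lambda>xs. mean p (\<lambda>x. (A xs + t * B x xs)^4))"
    by (simp add: A_def B_def pmean_mean)
  also have "\<dots> \<le> pmean ps (\<lambda>xs. ((A xs)\<^sup>2 + mean p (\<lambda>x. (B x xs)\<^sup>2))\<^sup>2)"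
    by (intro pmean_mono fourth_moment_mean) (use Cons.prems assms in \<open>auto simp: B_def\<close>)
  \<comment> \<open>The square of the inner mean becomes a double mean, so that \<open>CS\<close>
    applies to each pair \<open>B x\<close>, \<open>B y\<close>.\<close>
  also have "(\<lambda>xs. ((A xs)\<^sup>2 + mean p (\<lambda>x. (B x xs)\<^sup>2))\<^sup>2) =
      (\<lambda>xs. (A xs)^4 + 2 * mean p (\<lambda>x. (A xs)\<^sup>2 * (B x xs)\<^sup>2) + mean p (\<lambda>x. mean p (\<lambda>y. (B x xs)\<^sup>2 * (B y xs)\<^sup>2)))"
    by (simp add: mean_cmult mean_multc) (simp add: power2_eq_square power4_eq_xxxx algebra_simps)
  also have "pmean ps \<dots> = pmean ps (\<lambda>xs. (A xs)^4) + 2 * mean p (\<lambda>x. pmean ps (\<lambda>xs. (A xs)\<^sup>2 * (B x xs)\<^sup>2))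
      + mean p (\<lambda>x. mean p (\<lambda>y. pmean ps (\<lambda>xs. (B x xs)\<^sup>2 * (B y xs)\<^sup>2)))"
    by (simp add: pmean_add pmean_cmult pmean_mean)
  also have "\<dots> \<le> a\<^sup>2 + 2 * mean p (\<lambda>x. a * b x) + mean p (\<lambda>x. mean p (\<lambda>y. b x * b y))"
    by (intro add_mono mult_left_mono mean_mono CS A4 B4 nn) auto
  also have "\<dots> = (a + mean p b)\<^sup>2"
    by (simp add: mean_cmult mean_multc) (simp add: power2_eq_square algebra_simps)
  finally show ?case
    unfolding f2 .
qed auto

text \<open>
  Iterating this Cauchy--Schwarz step squares the rate each time, which carries the fourth moment
  bound from strong noise over to arbitrarily weak noise.
\<close>

lemma stab_square_le: "(stab ps (\<lambda>_. t) u)\<^sup>2 \<le> pmean ps (\<lambda>xs. (u xs)\<^sup>2) * stab ps (\<lambda>_. t\<^sup>2) u"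
  unfolding stab_eq[of ps "\<lambda>_. t"] pmean_noise_square[of ps "\<lambda>_. t", symmetric] by (rule pmean_Cauchy_Schwarz)

lemma stab_power_le:
  fixes ps :: "'b::finite pmf list" and u :: "'b list \<Rightarrow> real"
  assumes "0 \<le> t"
  defines "a \<equiv> pmean ps (\<lambda>xs. (u xs)\<^sup>2)"
  shows "a * stab ps (\<lambda>_. t) u ^ (2 ^ r) \<le> a ^ (2 ^ r) * stab ps (\<lambda>_. t ^ (2 ^ r)) u"
proof (induction r)
  case (Suc r)
  define s where "s r = stab ps (\<lambda>_. t ^ (2 ^ r)) u" for r
  have s: "0 \<le> s r" for r
    unfolding s_def using assms by (auto intro!: stab_nonneg)
  have "0 \<le> a"
    unfolding a_def by (auto intro: pmean_nonneg)
  show ?case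
  proof (cases "a = 0")
    case False
    \<comment> \<open>The additional factor \<open>a\<close> completes the square of the induction
      hypothesis and is cancelled at the end.\<close>
    have "a * (a * s 0 ^ (2 ^ Suc r)) = (a * s 0 ^ (2 ^ r))\<^sup>2"
      by (simp add: power_mult_distrib power2_eq_square mult_2 power_add mult_ac)
    also have "\<dots> \<le> (a ^ (2 ^ r) * s r)\<^sup>2"
      using Suc s[of 0] \<open>0 \<le> a\<close> unfolding s_def by (intro power_mono) auto
    also have "\<dots> = a ^ (2 ^ Suc r) * (s r)\<^sup>2"
      by (simp add: power_mult_distrib power2_eq_square mult_2 power_add mult_ac)
    also have "\<dots> \<le> a ^ (2 ^ Suc r) * (a * s (Suc r))"
      using stab_square_le[of ps "t ^ (2 ^ r)" u] \<open>0 \<le> a\<close> unfolding s_def a_def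
      by (intro mult_left_mono) (auto simp: power_mult mult.commute simp flip: power_mult)
    also have "\<dots> = a * (a ^ (2 ^ Suc r) * s (Suc r))"
      by simp
    finally show ?thesis
      using False \<open>0 \<le> a\<close> unfolding s_def by simp
  qed (use s[of "Suc r"] in \<open>simp add: s_def\<close>)
qed (simp add: a_def)

text \<open>Here \<open>a\<close> is the measure of the support of \<open>u\<close>, and the
  conclusion reads \<open>stab \<le> a ^ (1 + 1 / N)\<close> with \<open>N = 4 * 2 ^ r\<close>. It
  is first proved at the strong noise rate \<open>T\<close>, where the fourth moment bound is
  available, and then carried back to \<open>t\<close> by \<open>stab_power_le\<close>.\<close>

lemma small_set_expansion:
  fixes ps :: "'b::finite pmf list" and u :: "'b list \<Rightarrow> real"
  assumes ps: "\<forall>p\<in>set ps. min_atom \<alpha> p" "0 < \<alpha>" and t: "0 \<le> t" "t \<le> 1" "(t ^ (2 ^ r))\<^sup>2 \<le> \<alpha> / 4"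
    and u: "\<And>xs. u xs = - 1 \<or> u xs = 0 \<or> u xs = (1::real)"
  defines "a \<equiv> pmean ps (\<lambda>xs. (u xs)\<^sup>2)"
  shows "stab ps (\<lambda>_. t) u ^ (4 * 2 ^ r) \<le> a ^ Suc (4 * 2 ^ r)"
proof -
  define T where "T = t ^ (2 ^ r)"
  let ?N = "noise ps (\<lambda>_. T) u"
  have u3: "u xs * (u xs * u xs) = u xs" for xs
    using u[of xs] by auto
  have u4: "u xs ^ 4 = (u xs)\<^sup>2" for xs
    using u[of xs] by auto
  have uuN: "(u xs * u xs * c)\<^sup>2 = (u xs)\<^sup>2 * c\<^sup>2" for xs c
    using u[of xs] by auto
  have "0 \<le> a"
    unfolding a_def by (auto intro: pmean_nonneg)
  \<comment> \<open>Since \<open>u xs\<close> equals its cube, a factor \<open>u xs * u xs\<close>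
    can stay next to the noise; the second Cauchy--Schwarz step thus gains another power of
    \<open>a\<close>.\<close>
  have strong: "stab ps (\<lambda>_. T) u ^ 4 \<le> a ^ 5"
  proof -
    have "(stab ps (\<lambda>_. T) u)\<^sup>2 = (pmean ps (\<lambda>xs. u xs * (u xs * u xs * ?N xs)))\<^sup>2"
      unfolding stab_eq by (metis (no_types, lifting) u3 mult.assoc)
    also have "\<dots> \<le> a * pmean ps (\<lambda>xs. (u xs * u xs * ?N xs)\<^sup>2)"
      unfolding a_def by (rule pmean_Cauchy_Schwarz)
    also have "\<dots> = a * pmean ps (\<lambda>xs. (u xs)\<^sup>2 * (?N xs)\<^sup>2)"
      by (simp only: uuN)
    finally have 1: "(stab ps (\<lambda>_. T) u)\<^sup>2 \<le> a * pmean ps (\<lambda>xs. (u xs)\<^sup>2 * (?N xs)\<^sup>2)" .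
    have "(pmean ps (\<lambda>xs. (u xs)\<^sup>2 * (?N xs)\<^sup>2))\<^sup>2 \<le> pmean ps (\<lambda>xs. ((u xs)\<^sup>2)\<^sup>2) * pmean ps (\<lambda>xs. ((?N xs)\<^sup>2)\<^sup>2)"
      by (rule pmean_Cauchy_Schwarz)
    also have "\<dots> = a * pmean ps (\<lambda>xs. (?N xs)^4)"
      by (simp add: u4 a_def)
    also have "\<dots> \<le> a * a\<^sup>2"
      using fourth_moment_noise[OF ps, of T u] t \<open>0 \<le> a\<close> unfolding a_def T_def by (intro mult_left_mono) auto
    finally have 2: "(pmean ps (\<lambda>xs. (u xs)\<^sup>2 * (?N xs)\<^sup>2))\<^sup>2 \<le> a ^ 3"
      by (simp add: power2_eq_square power3_eq_cube)
    have "stab ps (\<lambda>_. T) u ^ 4 = ((stab ps (\<lambda>_. T) u)\<^sup>2)\<^sup>2"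
      by simp
    also have "\<dots> \<le> (a * pmean ps (\<lambda>xs. (u xs)\<^sup>2 * (?N xs)\<^sup>2))\<^sup>2"
      by (rule power_mono[OF 1]) simp
    also have "\<dots> = a\<^sup>2 * (pmean ps (\<lambda>xs. (u xs)\<^sup>2 * (?N xs)\<^sup>2))\<^sup>2"
      by (rule power_mult_distrib)
    also have "\<dots> \<le> a\<^sup>2 * a ^ 3"
      by (rule mult_left_mono[OF 2]) simp
    finally show ?thesis
      by (simp flip: power_add)
  qed
  show ?thesis
  proof (cases "a = 0")
    case True
    have "stab ps (\<lambda>_. t) u \<le> a" "0 \<le> stab ps (\<lambda>_. t) u"
      unfolding a_def stab_one[symmetric] using t stab_mono[of "\<lambda>_. t" "\<lambda>_. 1" ps u] by auto
    with True show ?thesis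
      by (simp add: power_0_left)
  next
    case False
    have "a ^ 4 * stab ps (\<lambda>_. t) u ^ (4 * 2 ^ r) = (a * stab ps (\<lambda>_. t) u ^ (2 ^ r)) ^ 4"
      by (simp add: power_mult_distrib mult.commute flip: power_mult)
    also have "\<dots> \<le> (a ^ (2 ^ r) * stab ps (\<lambda>_. T) u) ^ 4"
      using stab_power_le[of t ps u r] t \<open>0 \<le> a\<close> unfolding a_def T_def
      by (intro power_mono) (auto intro!: mult_nonneg_nonneg zero_le_power stab_nonneg)
    also have "\<dots> = a ^ (4 * 2 ^ r) * stab ps (\<lambda>_. T) u ^ 4"
      by (simp add: power_mult_distrib mult.commute flip: power_mult)
    also have "\<dots> \<le> a ^ (4 * 2 ^ r) * a ^ 5"
      by (rule mult_left_mono[OF strong]) (simp add: \<open>0 \<le> a\<close>)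
    also have "\<dots> = a ^ 4 * a ^ Suc (4 * 2 ^ r)"
      by (simp add: add.commute flip: power_add power_Suc)
    finally show ?thesis
      using False \<open>0 \<le> a\<close> by simp
  qed
qed

text \<open>The noisy function is tested against its sign \<open>u\<close> on the set where it is
  large, and self-adjointness moves the noise onto \<open>u\<close>. Small-set expansion then yields
  a power bound on the measure \<open>a\<close> of that set, which beats the linear bound once the
  norm of \<open>h\<close> is small.\<close>

lemma noise_tail_bound:
  assumes "0 < \<alpha>" "0 \<le> \<theta>" "\<theta> < 1" "0 < \<eta>" "0 < \<zeta>"
  obtains \<tau> where "0 < \<tau>" "\<And>(ps :: 'b::finite pmf list) h.
    \<forall>p\<in>set ps. min_atom \<alpha> p \<Longrightarrow> pmean ps (\<lambda>xs. (h xs)\<^sup>2) \<le> \<tau> \<Longrightarrow>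
    pmean ps (\<lambda>xs. of_bool (\<eta> < \<bar>noise ps (\<lambda>_. \<theta>) h xs\<bar>)) \<le> \<zeta> * pmean ps (\<lambda>xs. (h xs)\<^sup>2)"
proof -
  have \<theta>2: "0 \<le> \<theta>\<^sup>2" "\<theta>\<^sup>2 < 1"
    using assms by (auto simp: power_less_one_iff)
  \<comment> \<open>The rate is \<open>\<theta>\<^sup>2\<close> because \<open>stab\<close> at this
    rate is the squared norm of the noisy \<open>u\<close>; \<open>r\<close> squarings of it must
    reach the strong-noise range.\<close>
  obtain r where r: "(\<theta>\<^sup>2) ^ r < min (\<alpha> / 4) 1"
    using real_arch_pow_inv[of "min (\<alpha> / 4) 1" "\<theta>\<^sup>2"] assms \<theta>2 by auto
  have "((\<theta>\<^sup>2) ^ (2 ^ r))\<^sup>2 = (\<theta>\<^sup>2) ^ (2 ^ r * 2)"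
    by (simp add: power_mult)
  also have "\<dots> \<le> (\<theta>\<^sup>2) ^ r"
    using \<theta>2 less_exp[of r] by (intro power_decreasing) linarith+
  finally have strong: "((\<theta>\<^sup>2) ^ (2 ^ r))\<^sup>2 \<le> \<alpha> / 4"
    using r by simp
  \<comment> \<open>With the expansion exponent written as \<open>Suc M\<close>, cancelling
    \<open>a ^ Suc (Suc M)\<close> below leaves \<open>a ^ M\<close>.\<close>
  define M where "M = 4 * 2 ^ r - (1::nat)"
  have M: "4 * 2 ^ r = Suc M" "0 < M"
    by (auto simp: M_def Suc_lessI)
  \<comment> \<open>Half of the size that \<open>H\<close> would have to exceed for
    \<open>main\<close> to be compatible with \<open>\<zeta> * H < a\<close>.\<close>
  define \<tau> where "\<tau> = \<eta> ^ (2 * Suc M) * \<zeta> ^ M / 2"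
  show ?thesis
  proof
    show "0 < \<tau>"
      using assms by (simp add: \<tau>_def)
  next
    fix ps :: "'b pmf list" and h
    assume ps: "\<forall>p\<in>set ps. min_atom \<alpha> p"
    define H where "H = pmean ps (\<lambda>xs. (h xs)\<^sup>2)"
    assume "pmean ps (\<lambda>xs. (h xs)\<^sup>2) \<le> \<tau>"
    then have "H \<le> \<tau>"
      by (simp add: H_def)
    let ?g = "noise ps (\<lambda>_. \<theta>) h"
    define u where "u xs = (if \<eta> < \<bar>?g xs\<bar> then sgn (?g xs) else 0)" for xs
    define a where "a = pmean ps (\<lambda>xs. (u xs)\<^sup>2)"
    have u: "u xs = - 1 \<or> u xs = 0 \<or> u xs = 1" for xs
      by (auto simp: u_def sgn_if)
    have u2: "(u xs)\<^sup>2 = of_bool (\<eta> < \<bar>?g xs\<bar>)" for xs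
      using assms(4) by (auto simp: u_def sgn_if)
    have nn: "0 \<le> H" "0 \<le> a"
      unfolding H_def a_def by (auto intro: pmean_nonneg)
    have "\<eta> * a = pmean ps (\<lambda>xs. \<eta> * (u xs)\<^sup>2)"
      by (simp add: a_def pmean_cmult)
    also have "\<dots> \<le> pmean ps (\<lambda>xs. u xs * ?g xs)"
      by (rule pmean_mono) (use assms(4) in \<open>auto simp: u_def sgn_if\<close>)
    also have "\<dots> = pmean ps (\<lambda>xs. noise ps (\<lambda>_. \<theta>) u xs * h xs)"
      by (simp add: pmean_noise_mult)
    finally have "(\<eta> * a)\<^sup>2 \<le> (pmean ps (\<lambda>xs. noise ps (\<lambda>_. \<theta>) u xs * h xs))\<^sup>2"
      using nn assms by (intro power_mono) auto
    also have "\<dots> \<le> pmean ps (\<lambda>xs. (noise ps (\<lambda>_. \<theta>) u xs)\<^sup>2) * H"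
      unfolding H_def by (rule pmean_Cauchy_Schwarz)
    finally have "(\<eta> * a)\<^sup>2 \<le> stab ps (\<lambda>_. \<theta>\<^sup>2) u * H"
      by (simp add: pmean_noise_square)
    then have "((\<eta> * a)\<^sup>2) ^ Suc M \<le> (stab ps (\<lambda>_. \<theta>\<^sup>2) u * H) ^ Suc M"
      by (intro power_mono) auto
    also have "\<dots> = stab ps (\<lambda>_. \<theta>\<^sup>2) u ^ Suc M * H ^ Suc M"
      by (rule power_mult_distrib)
    also have "\<dots> \<le> a ^ Suc (Suc M) * H ^ Suc M"
      using small_set_expansion[OF ps \<open>0 < \<alpha>\<close> _ _ strong u] \<theta>2 nn unfolding M a_def
      by (intro mult_right_mono) auto
    finally have "a ^ Suc (Suc M) * (\<eta> ^ (2 * Suc M) * a ^ M) \<le> a ^ Suc (Suc M) * H ^ Suc M"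
      by (simp add: power_mult_distrib power_mult[symmetric] mult_ac flip: power_add)
         (simp add: power_mult power2_eq_square power_add power_mult_distrib mult_ac)
    then have main: "\<eta> ^ (2 * Suc M) * a ^ M \<le> H ^ Suc M" if "a \<noteq> 0"
      using that nn by (simp del: power_Suc)
    have "a \<le> \<zeta> * H"
    proof (rule ccontr)
      assume "\<not> a \<le> \<zeta> * H"
      then have less: "\<zeta> * H < a"
        by simp
      then have "a \<noteq> 0"
        using nn assms by (smt (verit) mult_nonneg_nonneg)
      have "\<eta> ^ (2 * Suc M) * (\<zeta> * H) ^ M < \<eta> ^ (2 * Suc M) * a ^ M"
        using less nn assms M by (intro mult_strict_left_mono power_strict_mono) auto
      also have "\<dots> \<le> H * H ^ M"
        using main[OF \<open>a \<noteq> 0\<close>] by simp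
      also have "\<dots> \<le> \<tau> * H ^ M"
        using \<open>H \<le> \<tau>\<close> nn by (intro mult_right_mono) auto
      finally have "2 * (\<tau> * H ^ M) < \<tau> * H ^ M"
        by (simp add: \<tau>_def power_mult_distrib mult_ac)
      moreover have "0 \<le> \<tau> * H ^ M"
        using nn assms by (simp add: \<tau>_def)
      ultimately show False
        by simp
    qed
    then show "pmean ps (\<lambda>xs. of_bool (\<eta> < \<bar>noise ps (\<lambda>_. \<theta>) h xs\<bar>)) \<le> \<zeta> * pmean ps (\<lambda>xs. (h xs)\<^sup>2)"
      by (simp add: a_def H_def u2)
  qed
qed

text \<open>Where the noisy function is at most \<open>\<xi> / 2\<close>, its cube is at most
  \<open>\<xi> / 2\<close> times its square; elsewhere the cube is at most \<open>1\<close> and the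
  tail bound applies.\<close>

lemma noise_third_moment:
  assumes "0 < \<alpha>" "0 \<le> \<theta>" "\<theta> < 1" "0 < \<xi>"
  obtains \<tau> where "0 < \<tau>" "\<And>(ps :: 'b::finite pmf list) h.
    \<forall>p\<in>set ps. min_atom \<alpha> p \<Longrightarrow> (\<And>xs. length xs = length ps \<Longrightarrow> \<bar>noise ps (\<lambda>_. \<theta>) h xs\<bar> \<le> 1) \<Longrightarrow>
    pmean ps (\<lambda>xs. (h xs)\<^sup>2) \<le> \<tau> \<Longrightarrow>
    pmean ps (\<lambda>xs. \<bar>noise ps (\<lambda>_. \<theta>) h xs\<bar> ^ 3) \<le> \<xi> * pmean ps (\<lambda>xs. (h xs)\<^sup>2)"
proof -
  obtain \<tau> where \<tau>: "0 < \<tau>" "\<And>(ps :: 'b pmf list) h.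
    \<forall>p\<in>set ps. min_atom \<alpha> p \<Longrightarrow> pmean ps (\<lambda>xs. (h xs)\<^sup>2) \<le> \<tau> \<Longrightarrow>
    pmean ps (\<lambda>xs. of_bool (\<xi> / 2 < \<bar>noise ps (\<lambda>_. \<theta>) h xs\<bar>)) \<le> \<xi> / 2 * pmean ps (\<lambda>xs. (h xs)\<^sup>2)"
    using noise_tail_bound[of \<alpha> \<theta> "\<xi> / 2" "\<xi> / 2"] assms by auto
  show ?thesis
  proof
    fix ps :: "'b pmf list" and h
    assume ps: "\<forall>p\<in>set ps. min_atom \<alpha> p" and le1: "\<And>xs. length xs = length ps \<Longrightarrow> \<bar>noise ps (\<lambda>_. \<theta>) h xs\<bar> \<le> 1"
      and h: "pmean ps (\<lambda>xs. (h xs)\<^sup>2) \<le> \<tau>"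
    let ?g = "noise ps (\<lambda>_. \<theta>) h"
    have "pmean ps (\<lambda>xs. \<bar>?g xs\<bar> ^ 3) \<le> pmean ps (\<lambda>xs. \<xi> / 2 * (?g xs)\<^sup>2 + of_bool (\<xi> / 2 < \<bar>?g xs\<bar>))"
    proof (rule pmean_mono_length)
      fix xs :: "'b list" assume "length xs = length ps"
      then have "\<bar>?g xs\<bar> \<le> 1"
        by (rule le1)
      have eq: "\<bar>?g xs\<bar> ^ 3 = \<bar>?g xs\<bar> * (?g xs)\<^sup>2"
        by (simp add: power3_eq_cube power2_eq_square abs_mult)
      show "\<bar>?g xs\<bar> ^ 3 \<le> \<xi> / 2 * (?g xs)\<^sup>2 + of_bool (\<xi> / 2 < \<bar>?g xs\<bar>)"
      proof (cases "\<xi> / 2 < \<bar>?g xs\<bar>")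
        case True
        have "\<bar>?g xs\<bar> ^ 3 \<le> 1"
          using \<open>\<bar>?g xs\<bar> \<le> 1\<close> by (simp add: power_le_one)
        with True assms show ?thesis
          by (simp add: add_increasing)
      next
        case False
        then show ?thesis
          unfolding eq using mult_right_mono[of "\<bar>?g xs\<bar>" "\<xi> / 2" "(?g xs)\<^sup>2"] by simp
      qed
    qed
    also have "\<dots> = \<xi> / 2 * stab ps (\<lambda>_. \<theta>\<^sup>2) h + pmean ps (\<lambda>xs. of_bool (\<xi> / 2 < \<bar>?g xs\<bar>))"
      by (simp add: pmean_add pmean_cmult pmean_noise_square del: times_divide_eq_left)
    also have "\<dots> \<le> \<xi> / 2 * stab ps (\<lambda>_. 1) h + \<xi> / 2 * pmean ps (\<lambda>xs. (h xs)\<^sup>2)"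
      using stab_mono[of "\<lambda>_. \<theta>\<^sup>2" "\<lambda>_. 1" ps h] assms \<tau>(2)[OF ps h]
      by (intro add_mono mult_left_mono) (auto simp: power_le_one)
    finally show "pmean ps (\<lambda>xs. \<bar>?g xs\<bar> ^ 3) \<le> \<xi> * pmean ps (\<lambda>xs. (h xs)\<^sup>2)"
      by (simp add: stab_one)
  qed (rule \<tau>(1))
qed

subsection \<open>Third moments of martingale differences\<close>

text \<open>
  With rates \<open>1\<close> below \<open>i\<close> and \<open>0\<close> above, \<open>ndiff\<close> is the \<open>i\<close>-th difference of the martingale that
  reveals the coordinates one by one.
\<close>

definition mart3 :: "'b::finite pmf list \<Rightarrow> ('b list \<Rightarrow> real) \<Rightarrow> real" where
  "mart3 ps g = (\<Sum>i<length ps. pmean ps (\<lambda>xs. \<bar>ndiff ps (\<lambda>k. of_bool (k < i)) i g xs\<bar> ^ 3))"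

text \<open>The first difference is the conditional mean given \<open>x\<close> minus the mean; once
  \<open>x\<close> is fixed, the later differences are those of
  \<open>\<lambda>zs. g (x # zs)\<close>.\<close>

lemma mart3_Cons:
  "mart3 (p # ps) g = mean p (\<lambda>x. \<bar>pmean ps (\<lambda>zs. g (x # zs)) - pmean (p # ps) g\<bar> ^ 3) +
     mean p (\<lambda>x. mart3 ps (\<lambda>zs. g (x # zs)))"
proof -
  have 0: "pmean (p # ps) (\<lambda>xs. \<bar>ndiff (p # ps) (\<lambda>k. of_bool (k < 0)) 0 g xs\<bar> ^ 3) =
      mean p (\<lambda>x. \<bar>pmean ps (\<lambda>zs. g (x # zs)) - pmean (p # ps) g\<bar> ^ 3)"
  proof -
    have "pmean ps (\<lambda>zs. \<bar>noise ps (\<lambda>_. 0) (dev p g x) zs\<bar> ^ 3) = \<bar>pmean ps (dev p g x)\<bar> ^ 3" for x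
      by (subst pmean_cong_length[of ps _ "\<lambda>_. \<bar>pmean ps (dev p g x)\<bar> ^ 3"]) (auto simp: noise_zero_rate)
    then show ?thesis
      by (simp add: ndiff_Cons_0 pmean_dev)
  qed
  have "avg p g zs + dev p g x zs = g (x # zs)" for x zs
    by (simp add: dev_def)
  then have S: "ndiff (p # ps) (\<lambda>k. of_bool (k < Suc i)) (Suc i) g (x # zs) =
      ndiff ps (\<lambda>k. of_bool (k < i)) i (\<lambda>zs. g (x # zs)) zs" for i x zs
    by (simp add: ndiff_Cons_Suc flip: ndiff_add)
  show ?thesis
    unfolding mart3_def list.size add_Suc_right add_0_right sum.lessThan_Suc_shift 0
    by (simp add: S mean_sum)
qed

text \<open>Switching the rate at \<open>i\<close> from \<open>0\<close> to \<open>1\<close> turns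
  the rates below \<open>i\<close> into those below \<open>Suc i\<close>, so the sum telescopes.
  These are the squared norms of orthogonal martingale differences.\<close>

lemma sum_influence_le:
  "(\<Sum>i<length ps. influence ps (\<lambda>k. of_bool (k < i)) i h) \<le> pmean ps (\<lambda>xs. (h xs)\<^sup>2)"
proof -
  define s where "s i = stab ps (\<lambda>k. of_bool (k < i)) h" for i
  have "(\<lambda>k. of_bool (k < i))(i := 1) = (\<lambda>k. of_bool (k < Suc i) :: real)" for i :: nat
    by (auto simp: fun_eq_iff)
  moreover have "(\<lambda>k. of_bool (k < i))(i := 0) = (\<lambda>k. of_bool (k < i) :: real)" for i :: nat
    by (auto simp: fun_eq_iff)
  ultimately have "(\<Sum>i<length ps. influence ps (\<lambda>k. of_bool (k < i)) i h) = (\<Sum>i<length ps. s (Suc i) - s i)"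
    by (simp add: influence_def s_def)
  also have "\<dots> = s (length ps) - s 0"
    by (rule sum_lessThan_telescope)
  also have "\<dots> \<le> stab ps (\<lambda>_. 1) h"
    using stab_mono[of "\<lambda>k. of_bool (k < length ps)" "\<lambda>_. 1" ps h] stab_nonneg[of "\<lambda>k. of_bool (k < 0)" ps h]
    unfolding s_def by simp
  finally show ?thesis
    by (simp add: stab_one)
qed

text \<open>The rate \<open>\<theta>\<^sup>2\<close> is split into two factors
  \<open>\<theta>\<close>. One stays inside \<open>h i\<close> and bounds its norm by an influence;
  the other is applied to \<open>h i\<close> and supplies the third moment bound. The norms of the
  \<open>h i\<close> are summed by telescoping.\<close>

lemma mart3_noise_le:
  assumes "0 < \<alpha>" "0 \<le> \<theta>" "\<theta> < 1" "0 < \<xi>"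
  obtains \<tau> where "0 < \<tau>" "\<And>(ps :: 'b::finite pmf list) f.
    \<forall>p\<in>set ps. min_atom \<alpha> p \<Longrightarrow> (\<And>xs. 0 \<le> f xs \<and> f xs \<le> 1) \<Longrightarrow>
    (\<And>i. i < length ps \<Longrightarrow> influence ps (\<lambda>_. \<theta>\<^sup>2) i f \<le> \<tau>) \<Longrightarrow>
    mart3 ps (noise ps (\<lambda>_. \<theta>\<^sup>2) f) \<le> \<xi>"
proof -
  obtain \<tau> where \<tau>: "0 < \<tau>" "\<And>(ps :: 'b pmf list) h.
    \<forall>p\<in>set ps. min_atom \<alpha> p \<Longrightarrow> (\<And>xs. length xs = length ps \<Longrightarrow> \<bar>noise ps (\<lambda>_. \<theta>) h xs\<bar> \<le> 1) \<Longrightarrow>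
    pmean ps (\<lambda>xs. (h xs)\<^sup>2) \<le> \<tau> \<Longrightarrow>
    pmean ps (\<lambda>xs. \<bar>noise ps (\<lambda>_. \<theta>) h xs\<bar> ^ 3) \<le> \<xi> * pmean ps (\<lambda>xs. (h xs)\<^sup>2)"
    using noise_third_moment[OF assms] by metis
  show ?thesis
  proof
    fix ps :: "'b pmf list" and f
    assume ps: "\<forall>p\<in>set ps. min_atom \<alpha> p" and f: "\<And>xs. 0 \<le> f xs \<and> f xs \<le> 1"
      and inf: "\<And>i. i < length ps \<Longrightarrow> influence ps (\<lambda>_. \<theta>\<^sup>2) i f \<le> \<tau>"
    define T where "T i = (\<lambda>k. of_bool (k < i) :: real)" for i :: nat
    have T: "(\<lambda>k. (T i k)\<^sup>2) = T i" for i
      by (auto simp: T_def)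
    define h where "h i = ndiff ps (T i) i (noise ps (\<lambda>_. \<theta>) f)" for i
    have nh: "noise ps (\<lambda>_. \<theta>) (h i) = ndiff ps (T i) i (noise ps (\<lambda>_. \<theta>\<^sup>2) f)" for i
      by (rule ext) (simp add: h_def noise_ndiff noise_noise power2_eq_square)
    have "pmean ps (\<lambda>xs. \<bar>noise ps (\<lambda>_. \<theta>) (h i) xs\<bar> ^ 3) \<le> \<xi> * pmean ps (\<lambda>xs. (h i xs)\<^sup>2)"
      if i: "i < length ps" for i
    proof (rule \<tau>(2)[OF ps])
      fix xs :: "'b list" assume len: "length xs = length ps"
      \<comment> \<open>Both terms of \<open>ndiff\<close> are noisy versions of \<open>f\<close>
        with values in \<open>[0,1]\<close>, so their difference is at most \<open>1\<close> in
        absolute value.\<close>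
      have "0 \<le> noise ps ((T i)(i := c)) (noise ps (\<lambda>_. \<theta>\<^sup>2) f) xs \<and>
          noise ps ((T i)(i := c)) (noise ps (\<lambda>_. \<theta>\<^sup>2) f) xs \<le> 1" if "c = 0 \<or> c = 1" for c
        unfolding noise_noise
        by (rule noise_range[OF _ f len]) (use that assms in \<open>auto simp: T_def power_le_one\<close>)
      from this[of 0] this[of 1] show "\<bar>noise ps (\<lambda>_. \<theta>) (h i) xs\<bar> \<le> 1"
        unfolding nh ndiff_def by auto
    next
      have "pmean ps (\<lambda>xs. (h i xs)\<^sup>2) = \<theta>\<^sup>2 * influence ps (\<lambda>k. (T i k * \<theta>)\<^sup>2) i f"
        unfolding h_def ndiff_noise by (simp add: power_mult_distrib pmean_cmult pmean_ndiff_square)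
      also have "\<dots> \<le> 1 * influence ps (\<lambda>_. \<theta>\<^sup>2) i f"
        using influence_mono[of "\<lambda>k. (T i k * \<theta>)\<^sup>2" "\<lambda>_. \<theta>\<^sup>2" ps i f] assms
        by (intro mult_mono) (auto simp: T_def power_le_one)
      finally show "pmean ps (\<lambda>xs. (h i xs)\<^sup>2) \<le> \<tau>"
        using inf[OF i] by simp
    qed
    then have "mart3 ps (noise ps (\<lambda>_. \<theta>\<^sup>2) f) \<le> (\<Sum>i<length ps. \<xi> * pmean ps (\<lambda>xs. (h i xs)\<^sup>2))"
      unfolding mart3_def by (intro sum_mono) (simp add: nh T_def)
    also have "\<dots> = \<xi> * (\<Sum>i<length ps. influence ps (T i) i (noise ps (\<lambda>_. \<theta>) f))"
      unfolding h_def by (simp add: pmean_ndiff_square T sum_distrib_left)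
    also have "\<dots> \<le> \<xi> * stab ps (\<lambda>_. \<theta>\<^sup>2) f"
      using sum_influence_le[of ps "noise ps (\<lambda>_. \<theta>) f"] assms(4)
      by (intro mult_left_mono) (auto simp: T_def pmean_noise_square)
    also have "\<dots> \<le> \<xi> * stab ps (\<lambda>_. 1) f"
      using stab_mono[of "\<lambda>_. \<theta>\<^sup>2" "\<lambda>_. 1" ps f] assms by (intro mult_left_mono) (auto simp: power_le_one)
    also have "\<dots> \<le> \<xi> * 1"
      unfolding stab_one using pmean_mono[of "\<lambda>xs. (f xs)\<^sup>2" "\<lambda>_. 1" ps] f assms(4)
      by (intro mult_left_mono) (auto simp: power_le_one)
    finally show "mart3 ps (noise ps (\<lambda>_. \<theta>\<^sup>2) f) \<le> \<xi>"
      by simp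
  qed (rule \<tau>(1))
qed

subsection \<open>The power of the product as an approximate submartingale\<close>

definition spread :: "real \<Rightarrow> ('l::finite \<Rightarrow> 'a::finite) pmf \<Rightarrow> bool" where
  "spread \<delta> p \<longleftrightarrow> (\<forall>V. (\<forall>j. mean p (\<lambda>x. V j (x j)) = 0) \<longrightarrow>
     \<delta> * (\<Sum>j\<in>UNIV. mean p (\<lambda>x. (V j (x j))\<^sup>2)) \<le> mean p (\<lambda>x. (\<Sum>j\<in>UNIV. V j (x j))\<^sup>2))"

text \<open>The logarithm bound gives \<open>1 + w \<ge> exp (w - 2 * w\<^sup>2)\<close>, so the
  product is at least \<open>exp S\<close>; and \<open>exp S \<ge> (1 + S / 2)\<^sup>2\<close> as
  long as \<open>S \<ge> - 2\<close>, which the smallness of \<open>\<eta>\<close> ensures.\<close>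

lemma prod_one_plus_power_ge:
  fixes W :: "'l::finite \<Rightarrow> real"
  assumes W: "\<And>j. \<bar>W j\<bar> \<le> \<eta>" and \<eta>: "\<eta> \<le> 1 / 2" "2 * real K * real CARD('l) * \<eta> \<le> 1"
  defines "S \<equiv> real K * ((\<Sum>j\<in>UNIV. W j) - 2 * (\<Sum>j\<in>UNIV. (W j)\<^sup>2))"
  shows "1 + S + S\<^sup>2 / 4 \<le> (\<Prod>j\<in>UNIV. (1 + W j) ^ K)"
proof -
  have "0 \<le> \<eta>"
    using W[of undefined] by linarith
  have W2: "(W j)\<^sup>2 \<le> \<eta> / 2" for j
  proof -
    have "(W j)\<^sup>2 = \<bar>W j\<bar> * \<bar>W j\<bar>"
      by (simp add: power2_eq_square)
    also have "\<dots> \<le> \<eta> * (1 / 2)"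
      using W[of j] \<eta> \<open>0 \<le> \<eta>\<close> by (intro mult_mono) auto
    finally show ?thesis
      by simp
  qed
  have "real CARD('l) * (- 2 * \<eta>) \<le> (\<Sum>j\<in>UNIV. W j - 2 * (W j)\<^sup>2)"
    using W W2 by (intro sum_bounded_below) (smt (verit, best) field_sum_of_halves)
  then have "real K * (real CARD('l) * (- 2 * \<eta>)) \<le> real K * (\<Sum>j\<in>UNIV. W j - 2 * (W j)\<^sup>2)"
    by (intro mult_left_mono) auto
  also have S_eq: "\<dots> = S"
    by (simp add: S_def sum_subtractf sum_distrib_left)
  finally have "real K * (real CARD('l) * (- 2 * \<eta>)) \<le> S" .
  then have "- 2 \<le> S"
    using \<eta>(2) by (simp add: mult_ac)
  have exp_le: "exp (real K * (W j - 2 * (W j)\<^sup>2)) \<le> (1 + W j) ^ K" for j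
  proof -
    have "\<bar>ln (1 + W j) - W j\<bar> \<le> 2 * (W j)\<^sup>2"
      using W[of j] \<eta> by (intro abs_ln_one_plus_x_minus_x_bound) auto
    then have "exp (W j - 2 * (W j)\<^sup>2) \<le> exp (ln (1 + W j))"
      by simp
    also have "\<dots> = 1 + W j"
      using W[of j] \<eta> by (intro exp_ln) auto
    finally have "exp (W j - 2 * (W j)\<^sup>2) ^ K \<le> (1 + W j) ^ K"
      by (intro power_mono) auto
    then show ?thesis
      by (simp add: exp_of_nat_mult)
  qed
  have "1 + S + S\<^sup>2 / 4 = (1 + S / 2)\<^sup>2"
    by (simp add: power2_eq_square algebra_simps)
  also have "\<dots> \<le> (exp (S / 2))\<^sup>2"
    using \<open>- 2 \<le> S\<close> exp_ge_add_one_self[of "S / 2"] by (intro power_mono) auto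
  also have "\<dots> = exp (\<Sum>j\<in>UNIV. real K * (W j - 2 * (W j)\<^sup>2))"
    by (simp add: exp_double[symmetric] S_eq flip: sum_distrib_left)
  also have "\<dots> = (\<Prod>j\<in>UNIV. exp (real K * (W j - 2 * (W j)\<^sup>2)))"
    by (simp add: exp_sum)
  also have "\<dots> \<le> (\<Prod>j\<in>UNIV. (1 + W j) ^ K)"
    by (intro prod_mono) (simp add: exp_le)
  finally show ?thesis .
qed

text \<open>The first-order term averages to \<open>0\<close>. The gain of order
  \<open>K\<^sup>2 * \<delta>\<close> from the square of the sum \<open>A\<close> beats the loss of
  order \<open>K\<close> from the sum of squares \<open>B\<close>, because
  \<open>K * \<delta>\<close> is at least \<open>32\<close>.\<close>

lemma mean_prod_one_plus_ge_1:
  fixes p :: "('l::finite \<Rightarrow> 'a::finite) pmf"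
  assumes "spread \<delta> p" and K: "32 \<le> real K * \<delta>"
    and W0: "\<And>j. mean p (\<lambda>x. W j (x j)) = 0"
    and W: "\<And>j x. x \<in> set_pmf p \<Longrightarrow> \<bar>W j (x j)\<bar> \<le> \<eta>"
    and \<eta>: "0 \<le> \<eta>" "\<eta> \<le> 1 / 2" "2 * real K * real CARD('l) * \<eta> \<le> 1"
  shows "1 \<le> mean p (\<lambda>x. \<Prod>j\<in>UNIV. (1 + W j (x j)) ^ K)"
proof -
  define A where "A x = (\<Sum>j\<in>UNIV. W j (x j))" for x
  define B where "B x = (\<Sum>j\<in>UNIV. (W j (x j))\<^sup>2)" for x
  have B: "0 \<le> B x" for x
    unfolding B_def by (simp add: sum_nonneg)
  have EB: "0 \<le> mean p B"
    by (rule mean_nonneg) (rule B)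
  have EA: "mean p A = 0"
    unfolding A_def by (simp add: mean_sum W0)
  have EA2: "\<delta> * mean p B \<le> mean p (\<lambda>x. (A x)\<^sup>2)"
    using assms(1) W0 unfolding spread_def A_def B_def by (simp add: mean_sum)
  have "mean p (\<lambda>x. 1 + real K * A x + (real K)\<^sup>2 / 8 * (A x)\<^sup>2 - 3 * real K * B x) \<le>
      mean p (\<lambda>x. \<Prod>j\<in>UNIV. (1 + W j (x j)) ^ K)"
  proof (rule mean_mono)
    fix x assume x: "x \<in> set_pmf p"
    have "B x \<le> real CARD('l) * (\<eta> * (1/2))"
      unfolding B_def
    proof (rule sum_bounded_above)
      fix j
      have "(W j (x j))\<^sup>2 = \<bar>W j (x j)\<bar> * \<bar>W j (x j)\<bar>"
        by (simp add: power2_eq_square)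
      also have "\<dots> \<le> \<eta> * (1/2)"
        using W[OF x, of j] \<eta> by (intro mult_mono) auto
      finally show "(W j (x j))\<^sup>2 \<le> \<eta> * (1/2)" .
    qed
    then have "real K * B x \<le> real K * (real CARD('l) * (\<eta> * (1/2)))"
      by (rule mult_left_mono) simp
    also have "\<dots> \<le> 1"
      using \<eta>(3) by (simp add: mult_ac)
    finally have KB: "real K * B x \<le> 1" .
    have "real K * B x * (real K * B x) \<le> real K * B x * 1"
      by (rule mult_left_mono[OF KB]) (simp add: B)
    then have "(real K * B x)\<^sup>2 \<le> real K * B x"
      by (simp add: power2_eq_square)
    \<comment> \<open>Completing the square gives up half of the quadratic gain for a loss
      \<open>(real K * B x)\<^sup>2\<close>, which is at most \<open>real K * B x\<close> by
      \<open>KB\<close>.\<close>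
    moreover have "(real K * (A x - 2 * B x))\<^sup>2 / 4 =
        (real K)\<^sup>2 / 8 * (A x)\<^sup>2 + (real K * (A x - 4 * B x))\<^sup>2 / 8 - (real K * B x)\<^sup>2"
      by (simp add: power2_eq_square field_simps)
    moreover have "0 \<le> (real K * (A x - 4 * B x))\<^sup>2 / 8"
      by simp
    moreover have "real K * (A x - 2 * B x) = real K * A x - 2 * (real K * B x)"
      by (simp add: algebra_simps)
    ultimately have "1 + real K * A x + (real K)\<^sup>2 / 8 * (A x)\<^sup>2 - 3 * real K * B x \<le>
        1 + real K * (A x - 2 * B x) + (real K * (A x - 2 * B x))\<^sup>2 / 4"
      by linarith
    also have "\<dots> \<le> (\<Prod>j\<in>UNIV. (1 + W j (x j)) ^ K)"
      unfolding A_def B_def by (rule prod_one_plus_power_ge[OF W[OF x] \<eta>(2,3)])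
    finally show "1 + real K * A x + (real K)\<^sup>2 / 8 * (A x)\<^sup>2 - 3 * real K * B x \<le> (\<Prod>j\<in>UNIV. (1 + W j (x j)) ^ K)" .
  qed
  moreover have "mean p (\<lambda>x. 1 + real K * A x + (real K)\<^sup>2 / 8 * (A x)\<^sup>2 - 3 * real K * B x) =
      1 + (real K)\<^sup>2 / 8 * mean p (\<lambda>x. (A x)\<^sup>2) - 3 * real K * mean p B"
    by (simp only: mean_add mean_diff mean_cmult EA mean_const mult_zero_right add_0_right)
  moreover have "3 * real K * mean p B \<le> (real K)\<^sup>2 / 8 * mean p (\<lambda>x. (A x)\<^sup>2)"
  proof -
    have "3 * real K * mean p B \<le> (real K * 32 / 8) * mean p B"
      using EB by (simp add: mult_right_mono)
    also have "\<dots> \<le> (real K * (real K * \<delta>) / 8) * mean p B"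
      using K EB by (intro mult_right_mono divide_right_mono mult_left_mono) auto
    also have "\<dots> = (real K)\<^sup>2 / 8 * (\<delta> * mean p B)"
      by (simp add: power2_eq_square)
    also have "\<dots> \<le> (real K)\<^sup>2 / 8 * mean p (\<lambda>x. (A x)\<^sup>2)"
      using EA2 by (intro mult_left_mono) auto
    finally show ?thesis .
  qed
  ultimately show ?thesis
    by linarith
qed

text \<open>If all increments are small relative to \<open>m j\<close>, division by
  \<open>m j\<close> reduces to \<open>mean_prod_one_plus_ge_1\<close>. Otherwise an increment
  comparable to \<open>m j\<close> occurs on an atom of mass at least \<open>\<alpha>\<close>, and
  its third moment already dominates the whole product.\<close>

lemma mean_prod_power_ge:
  fixes p :: "('l::finite \<Rightarrow> 'a::finite) pmf"
  assumes p: "spread \<delta> p" "min_atom \<alpha> p" "0 < \<alpha>" and K: "32 \<le> real K * \<delta>" "3 \<le> K"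
    and m: "\<And>j. 0 \<le> m j \<and> m j \<le> 1" and V0: "\<And>j. mean p (\<lambda>x. V j (x j)) = 0"
    and mV: "\<And>j x. 0 \<le> m j + V j (x j)"
  defines "C \<equiv> (2 * real K * real CARD('l)) ^ 3 / \<alpha>"
  shows "(\<Prod>j\<in>UNIV. m j ^ K) - C * (\<Sum>j\<in>UNIV. mean p (\<lambda>x. \<bar>V j (x j)\<bar> ^ 3)) \<le>
    mean p (\<lambda>x. \<Prod>j\<in>UNIV. (m j + V j (x j)) ^ K)"
proof -
  \<comment> \<open>With \<open>\<eta> = 1 / N\<close> the smallness condition of
    \<open>mean_prod_one_plus_ge_1\<close> holds with equality.\<close>
  define N where "N = 2 * real K * real CARD('l)"
  have "1 \<le> real CARD('l)"
    by (simp add: Suc_leI)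
  then have N: "2 * 3 * 1 \<le> N"
    unfolding N_def using K by (intro mult_mono) auto
  have nn: "0 \<le> mean p (\<lambda>x. \<Prod>j\<in>UNIV. (m j + V j (x j)) ^ K)"
    by (intro mean_nonneg prod_nonneg) (use mV in auto)
  have err: "0 \<le> mean p (\<lambda>x. \<bar>V j (x j)\<bar> ^ 3)" for j
    by (rule mean_nonneg) simp
  have C: "0 \<le> C"
    unfolding C_def using p by simp
  \<comment> \<open>All other factors are at most \<open>1\<close>, and \<open>K\<close> is at least
    \<open>3\<close>, so a third moment can compensate the product.\<close>
  have small: "(\<Prod>j\<in>UNIV. m j ^ K) \<le> m j ^ 3" for j
  proof -
    have "(\<Prod>j\<in>UNIV. m j ^ K) = m j ^ K * (\<Prod>i\<in>UNIV - {j}. m i ^ K)"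
      by (simp add: prod.remove)
    also have "\<dots> \<le> m j ^ K * 1"
      using m by (intro mult_left_mono prod_le_1) (auto simp: power_le_one)
    also have "\<dots> \<le> m j ^ 3"
      using m K(2) by (simp add: power_decreasing)
    finally show ?thesis .
  qed
  consider j where "m j = 0"
    | j x where "x \<in> set_pmf p" "m j < N * \<bar>V j (x j)\<bar>"
    | "\<And>j. 0 < m j" "\<And>j x. x \<in> set_pmf p \<Longrightarrow> N * \<bar>V j (x j)\<bar> \<le> m j"
    using m by (metis less_eq_real_def not_le)
  then show ?thesis
  proof cases
    case 1
    then have "(\<Prod>j\<in>UNIV. m j ^ K) \<le> 0"
      using small[of j] by simp
    moreover have "0 \<le> C * (\<Sum>j\<in>UNIV. mean p (\<lambda>x. \<bar>V j (x j)\<bar> ^ 3))"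
      using C err by (intro mult_nonneg_nonneg sum_nonneg)
    ultimately show ?thesis
      using nn by linarith
  next
    case 2
    have "(\<Prod>j\<in>UNIV. m j ^ K) \<le> m j ^ 3"
      by (rule small)
    also have "\<dots> \<le> (N * \<bar>V j (x j)\<bar>) ^ 3"
      using 2 m by (intro power_mono) auto
    also have "\<dots> = C * (\<alpha> * \<bar>V j (x j)\<bar> ^ 3)"
      using p(3) by (simp add: C_def N_def power_mult_distrib)
    also have "\<dots> \<le> C * (pmf p x * \<bar>V j (x j)\<bar> ^ 3)"
      using p(2) 2 C unfolding min_atom_def by (intro mult_left_mono mult_right_mono) auto
    also have "\<dots> \<le> C * mean p (\<lambda>x. \<bar>V j (x j)\<bar> ^ 3)"
      using C by (intro mult_left_mono mean_ge_atom) auto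
    also have "\<dots> \<le> C * (\<Sum>j\<in>UNIV. mean p (\<lambda>x. \<bar>V j (x j)\<bar> ^ 3))"
      using C err by (intro mult_left_mono member_le_sum) auto
    finally show ?thesis
      using nn by linarith
  next
    case 3
    define W where "W j a = V j a * (1 / m j)" for j a
    have "mean p (\<lambda>x. W j (x j)) = 0" for j
      unfolding W_def by (simp only: mean_multc V0 mult_zero_left)
    moreover have "\<bar>W j (x j)\<bar> \<le> 1 / N" if "x \<in> set_pmf p" for j x
      using 3(1)[of j] 3(2)[OF that, of j] N by (simp add: W_def abs_mult field_simps)
    moreover have "2 * real K * real CARD('l) * (1 / N) \<le> 1"
      using N by (simp add: N_def)
    ultimately have "1 \<le> mean p (\<lambda>x. \<Prod>j\<in>UNIV. (1 + W j (x j)) ^ K)"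
      using N by (intro mean_prod_one_plus_ge_1[OF p(1) K(1), of W "1 / N"]) (auto simp: field_simps)
    then have "(\<Prod>j\<in>UNIV. m j ^ K) * 1 \<le> (\<Prod>j\<in>UNIV. m j ^ K) * mean p (\<lambda>x. \<Prod>j\<in>UNIV. (1 + W j (x j)) ^ K)"
      using m by (intro mult_left_mono prod_nonneg) auto
    also have "\<dots> = mean p (\<lambda>x. \<Prod>j\<in>UNIV. (m j + V j (x j)) ^ K)"
    proof -
      have "m j * (1 + W j a) = m j + V j a" for j a
        using 3(1)[of j] by (simp add: W_def algebra_simps)
      then show ?thesis
        by (simp flip: mean_cmult prod.distrib power_mult_distrib)
    qed
    finally have "(\<Prod>j\<in>UNIV. m j ^ K) \<le> mean p (\<lambda>x. \<Prod>j\<in>UNIV. (m j + V j (x j)) ^ K)"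
      by simp
    moreover have "0 \<le> C * (\<Sum>j\<in>UNIV. mean p (\<lambda>x. \<bar>V j (x j)\<bar> ^ 3))"
      using C err by (intro mult_nonneg_nonneg sum_nonneg)
    ultimately show ?thesis
      by linarith
  qed
qed

section \<open>The submartingale bound over all coordinates\<close>

lemma mean_marginal: "mean (marginal p j) f = mean p (\<lambda>x. f (x j))"
  by (simp add: marginal_def mean_map)

lemma pmean_marginal: "pmean (map (\<lambda>p. marginal p j) ps) f = pmean ps (\<lambda>xs. f (map (\<lambda>x. x j) xs))"
  by (simp add: marginal_def pmean_map[of "\<lambda>x. x j"])

text \<open>Given the first tuple \<open>x\<close>, the conditional means are
  \<open>m j + V j (x j)\<close>. The one-step bound passes from \<open>m j\<close> to them, the
  induction hypothesis treats the rest, and \<open>mart3_Cons\<close> adds up the errors.\<close>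

lemma pmean_prod_power_ge:
  fixes ps :: "('l::finite \<Rightarrow> 'a::finite) pmf list"
  assumes ps: "\<forall>p\<in>set ps. spread \<delta> p \<and> min_atom \<alpha> p" "0 < \<alpha>" and K: "32 \<le> real K * \<delta>" "3 \<le> K"
    and g: "\<And>j xs. length xs = length ps \<Longrightarrow> 0 \<le> g j xs \<and> g j xs \<le> 1"
  defines "C \<equiv> (2 * real K * real CARD('l)) ^ 3 / \<alpha>"
  shows "(\<Prod>j\<in>UNIV. pmean (map (\<lambda>p. marginal p j) ps) (g j) ^ K) -
      C * (\<Sum>j\<in>UNIV. mart3 (map (\<lambda>p. marginal p j) ps) (g j)) \<le>
    pmean ps (\<lambda>xs. \<Prod>j\<in>UNIV. g j (map (\<lambda>x. x j) xs) ^ K)"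
  using ps(1) g
proof (induction ps arbitrary: g)
  case Nil
  then show ?case
    by (simp add: mart3_def)
next
  case (Cons p ps)
  define M where "M j = map (\<lambda>p. marginal p j) ps" for j
  define m where "m j = pmean (marginal p j # M j) (g j)" for j
  define V where "V j a = pmean (M j) (\<lambda>zs. g j (a # zs)) - m j" for j a
  have Vm: "m j + V j a = pmean (M j) (\<lambda>zs. g j (a # zs))" for j a
    by (simp add: V_def)
  have len: "length (M j) = length ps" for j
    by (simp add: M_def)
  have range: "0 \<le> pmean (M j) (\<lambda>zs. g j (a # zs)) \<and> pmean (M j) (\<lambda>zs. g j (a # zs)) \<le> 1" for j a
    using Cons.prems(2) pmean_mono_length[of "M j" "\<lambda>_. 0" "\<lambda>zs. g j (a # zs)"]
      pmean_mono_length[of "M j" "\<lambda>zs. g j (a # zs)" "\<lambda>_. 1"] by (simp add: len)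
  have mean_m: "mean p (\<lambda>x. pmean (M j) (\<lambda>zs. g j (x j # zs))) = m j" for j
    by (simp add: m_def mean_marginal)
  have m: "0 \<le> m j \<and> m j \<le> 1" for j
    unfolding mean_m[symmetric]
    using range mean_nonneg[of p] mean_mono[of p _ "\<lambda>_. 1"] by simp
  have IH: "(\<Prod>j\<in>UNIV. (m j + V j (x j)) ^ K) - C * (\<Sum>j\<in>UNIV. mart3 (M j) (\<lambda>zs. g j (x j # zs))) \<le>
      pmean ps (\<lambda>xs. \<Prod>j\<in>UNIV. g j (x j # map (\<lambda>x. x j) xs) ^ K)" for x
    unfolding Vm M_def using Cons.prems by (intro Cons.IH) auto
  have "(\<Prod>j\<in>UNIV. m j ^ K) - C * (\<Sum>j\<in>UNIV. mart3 (marginal p j # M j) (g j)) =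
      (\<Prod>j\<in>UNIV. m j ^ K) - C * (\<Sum>j\<in>UNIV. mean p (\<lambda>x. \<bar>V j (x j)\<bar> ^ 3))
        - C * (\<Sum>j\<in>UNIV. mean p (\<lambda>x. mart3 (M j) (\<lambda>zs. g j (x j # zs))))"
    unfolding mart3_Cons m_def[symmetric] V_def[symmetric] mean_marginal sum.distrib
    by (simp add: algebra_simps)
  also have "\<dots> \<le> mean p (\<lambda>x. \<Prod>j\<in>UNIV. (m j + V j (x j)) ^ K)
        - C * (\<Sum>j\<in>UNIV. mean p (\<lambda>x. mart3 (M j) (\<lambda>zs. g j (x j # zs))))"
  proof -
    have "(\<Prod>j\<in>UNIV. m j ^ K) - C * (\<Sum>j\<in>UNIV. mean p (\<lambda>x. \<bar>V j (x j)\<bar> ^ 3)) \<le> mean p (\<lambda>x. \<Prod>j\<in>UNIV. (m j + V j (x j)) ^ K)"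
      unfolding C_def
    proof (rule mean_prod_power_ge)
      show "mean p (\<lambda>x. V j (x j)) = 0" for j
        unfolding V_def mean_diff mean_m by simp
      show "0 \<le> m j + V j (x j)" for j and x :: "'l \<Rightarrow> 'a"
        using range by (simp add: Vm)
    qed (use Cons.prems m ps(2) K in auto)
    then show ?thesis
      by linarith
  qed
  also have "\<dots> = mean p (\<lambda>x. (\<Prod>j\<in>UNIV. (m j + V j (x j)) ^ K) - C * (\<Sum>j\<in>UNIV. mart3 (M j) (\<lambda>zs. g j (x j # zs))))"
    by (simp add: mean_diff mean_cmult mean_sum)
  also have "\<dots> \<le> mean p (\<lambda>x. pmean ps (\<lambda>xs. \<Prod>j\<in>UNIV. g j (x j # map (\<lambda>x. x j) xs) ^ K))"
    by (intro mean_mono IH)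
  finally show ?case
    by (simp add: m_def M_def)
qed

subsection \<open>Smoothing\<close>

text \<open>Conditional expectation given the value of \<open>r\<close>. Where that value has
  probability \<open>0\<close>, division by zero makes it \<open>0\<close>; hence the support
  condition in \<open>cexp_const\<close>.\<close>

definition cexp :: "'b::finite pmf \<Rightarrow> ('b \<Rightarrow> 'c) \<Rightarrow> ('b \<Rightarrow> real) \<Rightarrow> 'b \<Rightarrow> real" where
  "cexp p r \<phi> x = mean p (\<lambda>y. of_bool (r y = r x) * \<phi> y) / mean p (\<lambda>y. of_bool (r y = r x))"

lemma cexp_cong: "r x = r y \<Longrightarrow> cexp p r \<phi> x = cexp p r \<phi> y"
  by (simp add: cexp_def)

lemma cexp_pos: "x \<in> set_pmf p \<Longrightarrow> 0 < mean p (\<lambda>y. of_bool (r y = r x))"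
  using mean_ge_atom[of p "\<lambda>y. of_bool (r y = r x)" x] pmf_positive[of x p] by auto

lemma cexp_const: "x \<in> set_pmf p \<Longrightarrow> cexp p r (\<lambda>_. c) x = c"
  using cexp_pos[of x p r] by (simp add: cexp_def mean_multc)

lemma cexp_add: "cexp p r (\<lambda>x. f x + g x) x = cexp p r f x + cexp p r g x"
  by (simp add: cexp_def distrib_left mean_add add_divide_distrib)

lemma cexp_cmult: "cexp p r (\<lambda>x. c * f x) x = c * cexp p r f x"
  by (simp add: cexp_def mult.left_commute[of _ c] mean_cmult)

text \<open>The characteristic property of conditional expectation: after the two means are swapped,
  the weight \<open>1 / d y\<close> meets the probability \<open>d y\<close> of the level
  set.\<close>

lemma mean_cexp_mult:
  assumes "\<And>x y. r x = r y \<Longrightarrow> G x = G y"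
  shows "mean p (\<lambda>x. cexp p r \<phi> x * G x) = mean p (\<lambda>x. \<phi> x * G x)"
proof -
  define d where "d x = mean p (\<lambda>y. of_bool (r y = r x))" for x
  have d: "d x = d y" if "r x = r y" for x y
    using that by (simp add: d_def)
  have "cexp p r \<phi> x * G x = mean p (\<lambda>y. of_bool (r x = r y) * (\<phi> y * G y / d y))" for x
  proof -
    have "cexp p r \<phi> x * G x = mean p (\<lambda>y. of_bool (r y = r x) * \<phi> y * (G x / d x))"
      unfolding mean_multc by (simp add: cexp_def d_def)
    also have "\<dots> = mean p (\<lambda>y. of_bool (r x = r y) * (\<phi> y * G y / d y))"
    proof (rule mean_cong)
      fix y
      show "of_bool (r y = r x) * \<phi> y * (G x / d x) = of_bool (r x = r y) * (\<phi> y * G y / d y)"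
        using assms[of x y] d[of x y] by (cases "r y = r x") auto
    qed
    finally show ?thesis .
  qed
  then have "mean p (\<lambda>x. cexp p r \<phi> x * G x) = mean p (\<lambda>y. mean p (\<lambda>x. of_bool (r x = r y) * (\<phi> y * G y / d y)))"
    by (simp only:) (rule mean_swap)
  also have "\<dots> = mean p (\<lambda>y. d y * (\<phi> y * G y / d y))"
    by (simp only: mean_multc d_def)
  also have "\<dots> = mean p (\<lambda>x. \<phi> x * G x)"
    using cexp_pos[of _ p r] by (intro mean_cong) (force simp: d_def)
  finally show ?thesis .
qed

lemma mean_cexp: "mean p (cexp p r \<phi>) = mean p \<phi>"
  using mean_cexp_mult[of r "\<lambda>_. 1" p \<phi>] by simp

definition others :: "'l \<Rightarrow> ('l \<Rightarrow> 'a) \<Rightarrow> ('l \<Rightarrow> 'a)" where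
  "others j x = restrict x (UNIV - {j})"

text \<open>The conditional expectation of \<open>f\<close>, applied to the \<open>j\<close>-th
  entries, given all other entries. The coordinates are independent, so it is an iteration of
  one-coordinate conditional expectations.\<close>

primrec condexp :: "'l \<Rightarrow> ('l::finite \<Rightarrow> 'a::finite) pmf list \<Rightarrow> ('a list \<Rightarrow> real) \<Rightarrow> ('l \<Rightarrow> 'a) list \<Rightarrow> real" where
  "condexp j [] f xs = f []"
| "condexp j (p # ps) f xs =
     condexp j ps (\<lambda>ys. cexp p (others j) (\<lambda>x. f (x j # ys)) (hd xs)) (tl xs)"

lemma condexp_add: "condexp j ps (\<lambda>ys. f ys + g ys) xs = condexp j ps f xs + condexp j ps g xs"
  by (induction ps arbitrary: f g xs) (auto simp: cexp_add)

lemma condexp_cmult: "condexp j ps (\<lambda>ys. c * f ys) xs = c * condexp j ps f xs"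
  by (induction ps arbitrary: f xs) (auto simp: cexp_cmult)

lemma condexp_zero [simp]: "condexp j ps (\<lambda>_. 0) xs = 0"
  using condexp_cmult[of j ps 0 "\<lambda>_. 0" xs] by simp

lemma condexp_sum: "condexp j ps (\<lambda>ys. \<Sum>i\<in>I. f i ys) xs = (\<Sum>i\<in>I. condexp j ps (f i) xs)"
  by (induction I rule: infinite_finite_induct) (auto simp: condexp_add)

lemma condexp_mean: "condexp j ps (\<lambda>ys. mean p (\<lambda>z. f z ys)) xs = mean p (\<lambda>z. condexp j ps (f z) xs)"
  unfolding mean_def by (simp add: condexp_sum condexp_cmult)

lemma condexp_cong:
  "length xs = length ps \<Longrightarrow> map (others j) xs = map (others j) ys \<Longrightarrow> condexp j ps f xs = condexp j ps f ys"
proof (induction ps arbitrary: f xs ys)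
  case (Cons p ps)
  then obtain x xs' y ys' where "xs = x # xs'" "ys = y # ys'"
    by (metis length_map length_Suc_conv)
  with Cons show ?case
    using cexp_cong[of "others j" x y] by auto
qed auto

lemma pmean_condexp_mult:
  assumes "\<And>xs ys. length xs = length ps \<Longrightarrow> map (others j) xs = map (others j) ys \<Longrightarrow> G xs = G ys"
  shows "pmean ps (\<lambda>xs. condexp j ps f xs * G xs) = pmean ps (\<lambda>xs. f (map (\<lambda>x. x j) xs) * G xs)"
  using assms
proof (induction ps arbitrary: f G)
  case (Cons p ps)
  have "pmean (p # ps) (\<lambda>xs. condexp j (p # ps) f xs * G xs) =
      mean p (\<lambda>z. pmean ps (\<lambda>zs. cexp p (others j) (\<lambda>x. f (x j # map (\<lambda>x. x j) zs)) z * G (z # zs)))"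
    unfolding pmean.simps condexp.simps list.sel by (intro mean_cong Cons.IH) (auto intro!: Cons.prems)
  also have "\<dots> = pmean ps (\<lambda>zs. mean p (\<lambda>z. cexp p (others j) (\<lambda>x. f (x j # map (\<lambda>x. x j) zs)) z * G (z # zs)))"
    by (simp add: pmean_mean)
  also have "\<dots> = pmean ps (\<lambda>zs. mean p (\<lambda>z. f (z j # map (\<lambda>x. x j) zs) * G (z # zs)))"
    by (intro pmean_cong_length mean_cexp_mult) (auto intro!: Cons.prems)
  also have "\<dots> = pmean (p # ps) (\<lambda>xs. f (map (\<lambda>x. x j) xs) * G xs)"
    by (simp add: pmean_mean)
  finally show ?case .
qed auto

text \<open>The squared norm of the projection equals its inner product with \<open>f\<close>, so
  Cauchy--Schwarz shows that the projection is a contraction.\<close>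

lemma pmean_condexp_square_le:
  "pmean ps (\<lambda>xs. (condexp j ps f xs)\<^sup>2) \<le> pmean (map (\<lambda>p. marginal p j) ps) (\<lambda>ys. (f ys)\<^sup>2)"
proof -
  let ?U = "pmean ps (\<lambda>xs. (condexp j ps f xs)\<^sup>2)"
  have "?U = pmean ps (\<lambda>xs. f (map (\<lambda>x. x j) xs) * condexp j ps f xs)"
    unfolding power2_eq_square by (rule pmean_condexp_mult) (rule condexp_cong)
  then have "?U\<^sup>2 \<le> pmean ps (\<lambda>xs. (f (map (\<lambda>x. x j) xs))\<^sup>2) * ?U"
    using pmean_Cauchy_Schwarz[of ps "\<lambda>xs. f (map (\<lambda>x. x j) xs)" "condexp j ps f"] by simp
  moreover have "0 \<le> ?U" "0 \<le> pmean ps (\<lambda>xs. (f (map (\<lambda>x. x j) xs))\<^sup>2)"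
    by (auto intro: pmean_nonneg)
  ultimately show ?thesis
    unfolding pmean_marginal by (cases "?U = 0") (auto simp: power2_eq_square)
qed

text \<open>A bound on the squared operator norm of conditioning on the other entries, as an
  operator on mean-zero functions of the \<open>j\<close>-th entry.\<close>

definition contractive :: "real \<Rightarrow> 'l \<Rightarrow> ('l::finite \<Rightarrow> 'a::finite) pmf \<Rightarrow> bool" where
  "contractive c j p \<longleftrightarrow> (\<forall>\<phi>. mean p (\<lambda>x. \<phi> (x j)) = 0 \<longrightarrow>
     mean p (\<lambda>x. (cexp p (others j) (\<lambda>x. \<phi> (x j)) x)\<^sup>2) \<le> c * mean p (\<lambda>x. (\<phi> (x j))\<^sup>2))"

lemma cexp_noise: "noise ps t (\<lambda>ys. cexp p r (\<lambda>x. f x ys) z) xs = cexp p r (\<lambda>x. noise ps t (f x) xs) z"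
  unfolding cexp_def by (simp add: divide_inverse mult.commute[of _ "inverse _"] noise_cmult noise_mean)

text \<open>
  On an Efron--Stein component of degree \<open>d\<close> the conditional expectation contracts squared norms by
  \<open>c ^ d\<close>, whereas the noise defect is \<open>1 - \<theta> ^ d\<close>; the constant bounds \<open>c ^ d * (1 - \<theta> ^ d)\<^sup>2\<close> for all \<open>d\<close>.
\<close>

lemma pmean_condexp_noise_defect_le:
  fixes ps :: "('l::finite \<Rightarrow> 'a::finite) pmf list"
  assumes ps: "\<forall>p\<in>set ps. contractive c j p" and c: "0 \<le> c" "c < 1" and \<theta>: "0 \<le> \<theta>" "\<theta> \<le> 1"
  defines "\<kappa> \<equiv> c * (1 - \<theta>) / (1 - c)"
  shows "pmean ps (\<lambda>xs. (condexp j ps (\<lambda>ys. f ys - noise (map (\<lambda>p. marginal p j) ps) (\<lambda>_. \<theta>) f ys) xs)\<^sup>2) \<le>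
    \<kappa> * pmean (map (\<lambda>p. marginal p j) ps) (\<lambda>ys. (f ys)\<^sup>2)"
  using ps
proof (induction ps arbitrary: f)
  case Nil
  then show ?case
    using c \<theta> by (simp add: \<kappa>_def)
next
  case (Cons p ps)
  define M where "M = map (\<lambda>p. marginal p j) ps"
  let ?N = "noise M (\<lambda>_. \<theta>)"
  define f0 where "f0 = avg (marginal p j) f"
  define d where "d = dev (marginal p j) f"
  define F where "F z = (\<lambda>ys. cexp p (others j) (\<lambda>x. d (x j) ys) z)" for z
  define a where "a = condexp j ps (\<lambda>ys. f0 ys - ?N f0 ys)"
  define b where "b z = condexp j ps (\<lambda>ys. F z ys + (- \<theta>) * ?N (F z) ys)" for z
  have "0 \<le> \<kappa>"
    using c \<theta> by (simp add: \<kappa>_def)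
  \<comment> \<open>The fixed point equation that closes the induction: the deviation part costs
    \<open>1 - \<theta> + \<kappa>\<close> and gains the contraction factor \<open>c\<close> of the
    first coordinate.\<close>
  have \<kappa>: "(1 - \<theta> + \<kappa>) * c = \<kappa>"
    using c by (simp add: \<kappa>_def field_simps)
  have mean_d: "mean p (\<lambda>x. d (x j) ys) = 0" for ys
    using mean_marginal[of p j "\<lambda>y. dev (marginal p j) f y ys"] by (simp add: d_def)
  have mean_F: "mean p (\<lambda>z. F z ys) = 0" for ys
    unfolding F_def mean_cexp by (rule mean_d)
  have NF: "mean p (\<lambda>z. ?N (F z) ys) = 0" for ys
    unfolding noise_mean[symmetric] mean_F by (rule noise_zero)
  have mean_b: "mean p (\<lambda>z. b z zs) = 0" for zs
    unfolding b_def condexp_mean[symmetric] by (simp only: mean_F NF mean_add mean_cmult) simp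
  \<comment> \<open>The average keeps the full noise defect; the deviation sees the additional
    factor \<open>\<theta>\<close> and is replaced by its conditional expectation
    \<open>F z\<close>.\<close>
  have ab: "condexp j (p # ps) (\<lambda>ys. f ys - noise (marginal p j # M) (\<lambda>_. \<theta>) f ys) (z # zs) = a zs + b z zs"
    if z: "z \<in> set_pmf p" for z zs
  proof -
    have "f (y # ys) - noise (marginal p j # M) (\<lambda>_. \<theta>) f (y # ys) =
        (f0 ys - ?N f0 ys) + (d y ys + (- \<theta>) * ?N (d y) ys)" for y ys
      by (simp add: f0_def d_def dev_def)
    then have "cexp p (others j) (\<lambda>x. f (x j # ys) - noise (marginal p j # M) (\<lambda>_. \<theta>) f (x j # ys)) z =
        (f0 ys - ?N f0 ys) + (F z ys + (- \<theta>) * ?N (F z) ys)" for ys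
      by (simp only: cexp_add cexp_const[OF z] cexp_cmult F_def cexp_noise)
    then show ?thesis
      by (simp only: condexp.simps list.sel condexp_add a_def b_def)
  qed
  have "pmean (p # ps) (\<lambda>xs. (condexp j (p # ps) (\<lambda>ys. f ys - noise (marginal p j # M) (\<lambda>_. \<theta>) f ys) xs)\<^sup>2) =
      mean p (\<lambda>z. pmean ps (\<lambda>zs. (a zs + b z zs) * (a zs + b z zs)))"
    unfolding pmean.simps power2_eq_square by (intro mean_cong) (simp only: ab)
  also have "\<dots> = pmean ps (\<lambda>zs. (a zs)\<^sup>2) + mean p (\<lambda>z. pmean ps (\<lambda>zs. (b z zs)\<^sup>2))"
    by (simp add: mean_pmean_orthogonal mean_b power2_eq_square)
  also have "\<dots> \<le> \<kappa> * pmean M (\<lambda>ys. (f0 ys)\<^sup>2) + mean p (\<lambda>z. (1 - \<theta> + \<kappa>) * pmean M (\<lambda>ys. (F z ys)\<^sup>2))"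
  proof (intro add_mono mean_mono)
    show "pmean ps (\<lambda>zs. (a zs)\<^sup>2) \<le> \<kappa> * pmean M (\<lambda>ys. (f0 ys)\<^sup>2)"
      using Cons unfolding a_def M_def by auto
    fix z
    let ?u = "condexp j ps (F z)" and ?v = "condexp j ps (\<lambda>ys. F z ys - ?N (F z) ys)"
    \<comment> \<open>A convex combination of \<open>F z\<close> without noise and the noise defect
      of \<open>F z\<close>, to which the induction hypothesis applies.\<close>
    have "b z zs = (1 - \<theta>) * ?u zs + \<theta> * ?v zs" for zs
      unfolding b_def condexp_cmult[symmetric] condexp_add[symmetric] by (simp add: algebra_simps)
    moreover have "((1 - \<theta>) * x + \<theta> * y)\<^sup>2 \<le> (1 - \<theta>) * x\<^sup>2 + \<theta> * y\<^sup>2" for x y :: real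
    proof -
      have "(1 - \<theta>) * x\<^sup>2 + \<theta> * y\<^sup>2 - ((1 - \<theta>) * x + \<theta> * y)\<^sup>2 = \<theta> * (1 - \<theta>) * (x - y)\<^sup>2"
        by (simp add: power2_eq_square algebra_simps)
      moreover have "0 \<le> \<theta> * (1 - \<theta>) * (x - y)\<^sup>2"
        using \<theta> by simp
      ultimately show ?thesis
        by linarith
    qed
    ultimately have "pmean ps (\<lambda>zs. (b z zs)\<^sup>2) \<le> pmean ps (\<lambda>zs. (1 - \<theta>) * (?u zs)\<^sup>2 + \<theta> * (?v zs)\<^sup>2)"
      by (intro pmean_mono) simp
    also have "\<dots> = (1 - \<theta>) * pmean ps (\<lambda>zs. (?u zs)\<^sup>2) + \<theta> * pmean ps (\<lambda>zs. (?v zs)\<^sup>2)"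
      by (simp only: pmean_add pmean_cmult)
    also have "\<dots> \<le> (1 - \<theta>) * pmean M (\<lambda>ys. (F z ys)\<^sup>2) + 1 * (\<kappa> * pmean M (\<lambda>ys. (F z ys)\<^sup>2))"
    proof (intro add_mono mult_left_mono mult_mono)
      show "pmean ps (\<lambda>zs. (?u zs)\<^sup>2) \<le> pmean M (\<lambda>ys. (F z ys)\<^sup>2)"
        unfolding M_def by (rule pmean_condexp_square_le)
      show "pmean ps (\<lambda>zs. (?v zs)\<^sup>2) \<le> \<kappa> * pmean M (\<lambda>ys. (F z ys)\<^sup>2)"
        using Cons unfolding M_def by auto
    qed (use \<theta> in \<open>auto intro: pmean_nonneg\<close>)
    finally show "pmean ps (\<lambda>zs. (b z zs)\<^sup>2) \<le> (1 - \<theta> + \<kappa>) * pmean M (\<lambda>ys. (F z ys)\<^sup>2)"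
      by (simp add: algebra_simps)
  qed
  also have "mean p (\<lambda>z. (1 - \<theta> + \<kappa>) * pmean M (\<lambda>ys. (F z ys)\<^sup>2)) =
      (1 - \<theta> + \<kappa>) * pmean M (\<lambda>ys. mean p (\<lambda>z. (F z ys)\<^sup>2))"
    by (simp add: mean_cmult pmean_mean)
  also have "\<dots> \<le> (1 - \<theta> + \<kappa>) * pmean M (\<lambda>ys. c * mean p (\<lambda>x. (d (x j) ys)\<^sup>2))"
  proof (intro mult_left_mono pmean_mono)
    fix ys
    have "contractive c j p"
      using Cons.prems by simp
    from this[unfolded contractive_def, rule_format, of "\<lambda>y. d y ys", OF mean_d]
    show "mean p (\<lambda>z. (F z ys)\<^sup>2) \<le> c * mean p (\<lambda>x. (d (x j) ys)\<^sup>2)"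
      unfolding F_def .
  qed (use \<theta> \<open>0 \<le> \<kappa>\<close> in auto)
  also have "\<dots> = \<kappa> * mean (marginal p j) (\<lambda>y. pmean M (\<lambda>ys. (d y ys)\<^sup>2))"
    unfolding pmean_cmult mult.assoc[symmetric] \<kappa> by (simp add: pmean_mean mean_marginal)
  also have "\<kappa> * pmean M (\<lambda>ys. (f0 ys)\<^sup>2) + \<dots> = \<kappa> * pmean (marginal p j # M) (\<lambda>ys. (f ys)\<^sup>2)"
    unfolding stab_one[symmetric] by (simp add: f0_def d_def distrib_left)
  finally show ?case
    by (simp add: M_def)
qed

text \<open>A hybrid argument that replaces one factor at a time, at a cost of at most
  \<open>sqrt \<kappa>\<close> each.\<close>

lemma pmean_prod_noise_close:
  fixes ps :: "('l::finite \<Rightarrow> 'a::finite) pmf list"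
  assumes ps: "\<forall>p\<in>set ps. \<forall>j. contractive c j p" and c: "0 \<le> c" "c < 1" and \<theta>: "0 \<le> \<theta>" "\<theta> \<le> 1"
    and f: "\<And>j xs. 0 \<le> f j xs \<and> f j xs \<le> 1"
  defines "Nf \<equiv> (\<lambda>j. noise (map (\<lambda>p. marginal p j) ps) (\<lambda>_. \<theta>) (f j))"
  shows "\<bar>pmean ps (\<lambda>xs. \<Prod>j\<in>UNIV. f j (map (\<lambda>x. x j) xs)) - pmean ps (\<lambda>xs. \<Prod>j\<in>UNIV. Nf j (map (\<lambda>x. x j) xs))\<bar>
    \<le> real CARD('l) * sqrt (c * (1 - \<theta>) / (1 - c))"
proof -
  define \<kappa> where "\<kappa> = c * (1 - \<theta>) / (1 - c)"
  have "0 \<le> \<kappa>"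
    using c \<theta> by (simp add: \<kappa>_def)
  define h where "h S j = (if j \<in> S then Nf j else f j)" for S j
  have h: "0 \<le> h S j ys \<and> h S j ys \<le> 1" if "length ys = length ps" for S j ys
    unfolding h_def Nf_def using noise_range[of "\<lambda>_. \<theta>" "f j" ys "map (\<lambda>p. marginal p j) ps"] that f \<theta> by auto
  define I where "I S = pmean ps (\<lambda>xs. \<Prod>j\<in>UNIV. h S j (map (\<lambda>x. x j) xs))" for S
  have "\<bar>I {} - I S\<bar> \<le> real (card S) * sqrt \<kappa>" for S
    using finite[of S]
  proof (induction S rule: finite_induct)
    case (insert j S)
    define G where "G xs = (\<Prod>i\<in>UNIV - {j}. h S i (map (\<lambda>x. x i) xs))" for xs :: "('l \<Rightarrow> 'a) list"
    have G_cong: "G xs = G ys" if "map (others j) xs = map (others j) ys" for xs ys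
    proof -
      have "map (\<lambda>x. x i) xs = map (\<lambda>x. x i) ys" if "i \<noteq> j" for i
      proof -
        have *: "map (\<lambda>x. x i) zs = map (\<lambda>x. x i) (map (others j) zs)" for zs :: "('l \<Rightarrow> 'a) list"
          using that by (simp add: others_def comp_def)
        show ?thesis
          unfolding *[of xs] *[of ys] by (simp only: \<open>map (others j) xs = map (others j) ys\<close>)
      qed
      then show ?thesis
        by (auto simp: G_def intro!: prod.cong)
    qed
    have G: "0 \<le> G xs \<and> G xs \<le> 1" if "length xs = length ps" for xs
      unfolding G_def using h that by (auto intro!: prod_nonneg prod_le_1)
    have "I S - I (insert j S) = pmean ps (\<lambda>xs. (f j (map (\<lambda>x. x j) xs) - Nf j (map (\<lambda>x. x j) xs)) * G xs)"
      unfolding I_def pmean_diff[symmetric]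
    proof (rule arg_cong[where f = "pmean ps"], rule ext)
      fix xs
      have "(\<Prod>i\<in>UNIV - {j}. h (insert j S) i (map (\<lambda>x. x i) xs)) = G xs"
        unfolding G_def by (rule prod.cong) (auto simp: h_def)
      moreover have "(\<Prod>i\<in>UNIV. h S' i (map (\<lambda>x. x i) xs)) =
          h S' j (map (\<lambda>x. x j) xs) * (\<Prod>i\<in>UNIV - {j}. h S' i (map (\<lambda>x. x i) xs))" for S'
        by (rule prod.remove) auto
      moreover have "h S j = f j" "h (insert j S) j = Nf j"
        using insert by (auto simp: h_def)
      ultimately show "(\<Prod>i\<in>UNIV. h S i (map (\<lambda>x. x i) xs)) - (\<Prod>i\<in>UNIV. h (insert j S) i (map (\<lambda>x. x i) xs)) =
          (f j (map (\<lambda>x. x j) xs) - Nf j (map (\<lambda>x. x j) xs)) * G xs"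
        by (simp only: left_diff_distrib G_def)
    qed
    \<comment> \<open>The remaining factors do not depend on the \<open>j\<close>-th entries, so the
      difference may be conditioned on the other entries; only this makes it small in norm.\<close>
    also have "\<dots> = pmean ps (\<lambda>xs. condexp j ps (\<lambda>ys. f j ys - Nf j ys) xs * G xs)"
      by (rule pmean_condexp_mult[symmetric, where f = "\<lambda>ys. f j ys - Nf j ys"]) (rule G_cong)
    finally have "(I S - I (insert j S))\<^sup>2 \<le>
        pmean ps (\<lambda>xs. (condexp j ps (\<lambda>ys. f j ys - Nf j ys) xs)\<^sup>2) * pmean ps (\<lambda>xs. (G xs)\<^sup>2)"
      by (simp add: pmean_Cauchy_Schwarz)
    also have "\<dots> \<le> (\<kappa> * pmean (map (\<lambda>p. marginal p j) ps) (\<lambda>ys. (f j ys)\<^sup>2)) * 1"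
    proof (rule mult_mono)
      show "pmean ps (\<lambda>xs. (condexp j ps (\<lambda>ys. f j ys - Nf j ys) xs)\<^sup>2) \<le>
          \<kappa> * pmean (map (\<lambda>p. marginal p j) ps) (\<lambda>ys. (f j ys)\<^sup>2)"
        unfolding Nf_def \<kappa>_def using ps c \<theta> by (intro pmean_condexp_noise_defect_le) auto
      show "pmean ps (\<lambda>xs. (G xs)\<^sup>2) \<le> 1"
        using pmean_mono_length[of ps "\<lambda>xs. (G xs)\<^sup>2" "\<lambda>_. 1"] G by (simp add: power_le_one)
    qed (use \<open>0 \<le> \<kappa>\<close> in \<open>auto intro!: pmean_nonneg mult_nonneg_nonneg\<close>)
    also have "\<dots> \<le> (\<kappa> * 1) * 1"
      using pmean_mono[of "\<lambda>ys. (f j ys)\<^sup>2" "\<lambda>_. 1" "map (\<lambda>p. marginal p j) ps"] f \<open>0 \<le> \<kappa>\<close>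
      by (intro mult_right_mono mult_left_mono) (auto simp: power_le_one)
    finally have "\<bar>I S - I (insert j S)\<bar> \<le> sqrt \<kappa>"
      by (simp add: real_le_rsqrt)
    with insert show ?case
      by (simp add: algebra_simps)
  qed (auto simp: I_def)
  from this[of UNIV] show ?thesis
    by (simp add: I_def h_def \<kappa>_def)
qed

subsection \<open>Consequences of bounded correlation\<close>

text \<open>Scaling to variance \<open>1\<close> makes the pair admissible in the supremum; if a
  variance is \<open>0\<close>, Cauchy--Schwarz makes the covariance \<open>0\<close>. The bound
  \<open>\<rho>\<close> may be very negative when no pair is admissible, and
  \<open>max \<rho> 0\<close> has a square below \<open>1\<close> even then.\<close>

lemma correlation_bound:
  fixes P :: "('l::finite \<Rightarrow> 'a::finite) pmf"
  assumes "max_correlation P \<le> ereal \<rho>" and phi0: "mean P (\<lambda>x. \<phi> (x j)) = 0" and G0: "mean P (\<lambda>x. g (others j x)) = 0"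
  shows "mean P (\<lambda>x. \<phi> (x j) * g (others j x)) \<le>
    max \<rho> 0 * (sqrt (mean P (\<lambda>x. (\<phi> (x j))\<^sup>2)) * sqrt (mean P (\<lambda>x. (g (others j x))\<^sup>2)))"
proof -
  define C where "C = mean P (\<lambda>x. \<phi> (x j) * g (others j x))"
  define a where "a = mean P (\<lambda>x. (\<phi> (x j))\<^sup>2)"
  define b where "b = mean P (\<lambda>x. (g (others j x))\<^sup>2)"
  have nn: "0 \<le> a" "0 \<le> b"
    unfolding a_def b_def by (auto intro: mean_nonneg)
  show ?thesis
  proof (cases "a = 0 \<or> b = 0")
    case True
    have "C\<^sup>2 \<le> a * b"
      unfolding C_def a_def b_def by (rule mean_Cauchy_Schwarz)
    with True have "C = 0"
      by auto
    then show ?thesis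
      using nn unfolding C_def a_def b_def by simp
  next
    case False
    then have pos: "0 < a" "0 < b"
      using nn by auto
    define F where "F = (\<lambda>z. 1 / sqrt a * \<phi> (z j))"
    define H where "H = (\<lambda>z. 1 / sqrt b * g z)"
    have F: "F (restrict x {j}) = 1 / sqrt a * \<phi> (x j)" for x
      by (simp add: F_def)
    have H: "H (restrict x (UNIV - {j})) = 1 / sqrt b * g (others j x)" for x
      by (simp add: H_def others_def)
    have EF: "mean P (\<lambda>x. F (restrict x {j})) = 0" and EH: "mean P (\<lambda>x. H (restrict x (UNIV - {j}))) = 0"
      unfolding F H by (simp_all only: mean_cmult phi0 G0 mult_zero_right)
    have sq: "(1 / sqrt e * y)\<^sup>2 = 1 / e * y\<^sup>2" if "0 < e" for e y
      using that by (simp add: power_divide power_mult_distrib)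
    have "measure_pmf.variance P (\<lambda>x. F (restrict x {j})) = 1"
      unfolding mean_eq_expectation[symmetric] EF unfolding F
      unfolding diff_zero sq[OF pos(1)] mean_cmult a_def[symmetric] using pos by simp
    moreover have "measure_pmf.variance P (\<lambda>x. H (restrict x (UNIV - {j}))) = 1"
      unfolding mean_eq_expectation[symmetric] EH unfolding H
      unfolding diff_zero sq[OF pos(2)] mean_cmult b_def[symmetric] using pos by simp
    moreover have "covariance P (\<lambda>x. F (restrict x {j})) (\<lambda>x. H (restrict x (UNIV - {j}))) = 1 / (sqrt a * sqrt b) * C"
    proof -
      have "covariance P (\<lambda>x. F (restrict x {j})) (\<lambda>x. H (restrict x (UNIV - {j}))) =
          mean P (\<lambda>x. 1 / (sqrt a * sqrt b) * (\<phi> (x j) * g (others j x)))"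
        unfolding covariance_def mean_eq_expectation[symmetric] EF EH unfolding F H by (simp add: mult_ac)
      then show ?thesis
        by (simp only: mean_cmult C_def)
    qed
    ultimately have "ereal (1 / (sqrt a * sqrt b) * C) \<le> correlation P {j} (UNIV - {j})"
      unfolding correlation_def by (intro Sup_upper CollectI exI[of _ F] exI[of _ H]) simp
    also have "\<dots> \<le> max_correlation P"
      unfolding max_correlation_def by (rule Max_ge) auto
    also have "\<dots> \<le> ereal \<rho>"
      by fact
    finally have "C \<le> \<rho> * (sqrt a * sqrt b)"
      using pos by (simp add: field_simps)
    also have "\<dots> \<le> max \<rho> 0 * (sqrt a * sqrt b)"
      using nn by (intro mult_right_mono) auto
    finally show ?thesis
      unfolding C_def a_def b_def .
  qed
qed

lemma others_others [simp]: "others j (others j x) = others j x"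
  by (auto simp: others_def)

text \<open>The conditional expectation \<open>g\<close> is itself a function of the other entries
  and its squared norm is its inner product with \<open>\<phi>\<close>; the correlation bound then
  allows one factor \<open>sqrt b\<close> to be cancelled.\<close>

lemma max_correlation_contractive:
  fixes P :: "('l::finite \<Rightarrow> 'a::finite) pmf"
  assumes "max_correlation P \<le> ereal \<rho>"
  shows "contractive ((max \<rho> 0)\<^sup>2) j P"
  unfolding contractive_def
proof (intro allI impI)
  fix \<phi> :: "'a \<Rightarrow> real" assume \<phi>0: "mean P (\<lambda>x. \<phi> (x j)) = 0"
  define g where "g = cexp P (others j) (\<lambda>x. \<phi> (x j))"
  have g: "g (others j x) = g x" for x
    unfolding g_def by (rule cexp_cong) simp
  define a b where "a = mean P (\<lambda>x. (\<phi> (x j))\<^sup>2)" and "b = mean P (\<lambda>x. (g x)\<^sup>2)"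
  have nn: "0 \<le> a" "0 \<le> b"
    unfolding a_def b_def by (auto intro: mean_nonneg)
  have "b = mean P (\<lambda>x. \<phi> (x j) * g x)"
    unfolding b_def power2_eq_square g_def by (intro mean_cexp_mult cexp_cong)
  also have "\<dots> \<le> max \<rho> 0 * (sqrt a * sqrt b)"
    using correlation_bound[OF assms \<phi>0, of g] \<phi>0 by (simp add: g a_def b_def) (simp add: g_def mean_cexp)
  finally have "sqrt b * sqrt b \<le> (max \<rho> 0 * sqrt a) * sqrt b"
    using nn by (simp add: mult_ac)
  then have "sqrt b \<le> max \<rho> 0 * sqrt a"
  proof (cases "b = 0")
    case True
    then show ?thesis
      using nn by simp
  next
    case False
    then have "0 < sqrt b"
      using nn by simp
    with mult_right_le_imp_le \<open>sqrt b * sqrt b \<le> _\<close> show ?thesis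
      by blast
  qed
  then have "(sqrt b)\<^sup>2 \<le> (max \<rho> 0 * sqrt a)\<^sup>2"
    using nn by (intro power_mono) auto
  then show "mean P (\<lambda>x. (cexp P (others j) (\<lambda>x. \<phi> (x j)) x)\<^sup>2) \<le> (max \<rho> 0)\<^sup>2 * mean P (\<lambda>x. (\<phi> (x j))\<^sup>2)"
    using nn by (simp add: power_mult_distrib a_def b_def g_def)
qed

text \<open>For each \<open>j\<close> the sum is \<open>V j\<close> minus a function
  \<open>g\<close> of the other entries, and \<open>a - 2 * r * sqrt a * sqrt b + b\<close> is at
  least \<open>(1 - r\<^sup>2) * a\<close>. Averaging over \<open>j\<close> produces the divisor
  \<open>CARD('l)\<close>.\<close>

lemma max_correlation_spread:
  fixes P :: "('l::finite \<Rightarrow> 'a::finite) pmf"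
  assumes "max_correlation P \<le> ereal \<rho>"
  shows "spread ((1 - (max \<rho> 0)\<^sup>2) / real CARD('l)) P"
  unfolding spread_def
proof (intro allI impI)
  fix V :: "'l \<Rightarrow> 'a \<Rightarrow> real" assume V0: "\<forall>j. mean P (\<lambda>x. V j (x j)) = 0"
  define r where "r = max \<rho> 0"
  define Q where "Q = mean P (\<lambda>x. (\<Sum>j\<in>UNIV. V j (x j))\<^sup>2)"
  have "(1 - r\<^sup>2) * mean P (\<lambda>x. (V j (x j))\<^sup>2) \<le> Q" for j
  proof -
    define g where "g x = - (\<Sum>i\<in>UNIV - {j}. V i (x i))" for x
    have g: "g (others j x) = g x" for x
      by (simp add: g_def others_def)
    define a b where "a = mean P (\<lambda>x. (V j (x j))\<^sup>2)" and "b = mean P (\<lambda>x. (g x)\<^sup>2)"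
    have nn: "0 \<le> a" "0 \<le> b"
      unfolding a_def b_def by (auto intro: mean_nonneg)
    have "mean P g = mean P (\<lambda>x. - 1 * (\<Sum>i\<in>UNIV - {j}. V i (x i)))"
      by (simp add: g_def[abs_def])
    also have "\<dots> = 0"
      unfolding mean_cmult mean_sum using V0 by simp
    finally have g0: "mean P g = 0" .
    have "mean P (\<lambda>x. V j (x j) * g x) \<le> r * (sqrt a * sqrt b)"
      using correlation_bound[OF assms, of "V j" j g] V0 g0 by (simp add: g a_def b_def r_def)
    moreover have "(\<Sum>i\<in>UNIV. V i (x i))\<^sup>2 = (V j (x j))\<^sup>2 - 2 * (V j (x j) * g x) + (g x)\<^sup>2" for x
    proof -
      have "(\<Sum>i\<in>UNIV. V i (x i)) = V j (x j) - g x"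
        by (simp add: g_def sum.remove[of UNIV j])
      then show ?thesis
        by (simp add: power2_diff)
    qed
    then have "Q = a - 2 * mean P (\<lambda>x. V j (x j) * g x) + b"
      by (simp only: mean_add mean_diff mean_cmult a_def b_def Q_def)
    moreover have "0 \<le> (r * sqrt a - sqrt b)\<^sup>2"
      by simp
    then have "2 * (r * (sqrt a * sqrt b)) \<le> r\<^sup>2 * a + b"
      using nn by (simp add: power2_diff power_mult_distrib mult_ac)
    ultimately show ?thesis
      by (simp add: a_def[symmetric] algebra_simps)
  qed
  then have "(\<Sum>j\<in>UNIV. (1 - r\<^sup>2) * mean P (\<lambda>x. (V j (x j))\<^sup>2)) \<le> real CARD('l) * Q"
    by (rule sum_bounded_above)
  then have "(1 - r\<^sup>2) * (\<Sum>j\<in>UNIV. mean P (\<lambda>x. (V j (x j))\<^sup>2)) \<le> Q * real CARD('l)"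
    by (simp add: sum_distrib_left mult.commute)
  then show "(1 - (max \<rho> 0)\<^sup>2) / real CARD('l) * (\<Sum>j\<in>UNIV. mean P (\<lambda>x. (V j (x j))\<^sup>2)) \<le> Q"
    by (simp add: r_def field_simps)
qed

text \<open>Point masses satisfy the conditions imposed on \<open>P\<close>, so the estimates remain
  valid with the same constants after a restriction.\<close>

lemma contractive_return: "0 \<le> c \<Longrightarrow> contractive c j (return_pmf a)"
  by (auto simp: contractive_def cexp_def)

lemma spread_return: "spread \<delta> (return_pmf a)"
  by (auto simp: spread_def)

lemma min_atom_return: "\<alpha> \<le> 1 \<Longrightarrow> min_atom \<alpha> (return_pmf a)"
  by (auto simp: min_atom_def)

lemma min_atom_marginal:
  fixes p :: "('l::finite \<Rightarrow> 'a::finite) pmf"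
  assumes "min_atom \<alpha> p"
  shows "min_atom \<alpha> (marginal p j)"
  unfolding min_atom_def
proof
  fix a assume "a \<in> set_pmf (marginal p j)"
  then obtain x where x: "x \<in> set_pmf p" "a = x j"
    by (auto simp: marginal_def)
  have "pmf p x * of_bool (x j = a) \<le> mean p (\<lambda>y. of_bool (y j = a))"
    by (rule mean_ge_atom) simp
  also have "\<dots> = mean (marginal p j) (\<lambda>b. of_bool (b = a))"
    by (simp add: mean_marginal)
  also have "\<dots> = pmf (marginal p j) a"
    by (simp add: mean_def of_bool_def if_distrib cong: if_cong)
  finally show "\<alpha> \<le> pmf (marginal p j) a"
    using assms x by (auto simp: min_atom_def)
qed

lemma min_atom_exists: "\<exists>\<alpha>. 0 < \<alpha> \<and> \<alpha> \<le> 1 \<and> min_atom \<alpha> (p :: 'b::finite pmf)"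
proof (intro exI conjI)
  have fin: "finite (pmf p ` set_pmf p)" "pmf p ` set_pmf p \<noteq> {}"
    by (auto simp: set_pmf_not_empty)
  show "0 < Min (pmf p ` set_pmf p)"
    using fin by (auto simp: pmf_positive)
  show "Min (pmf p ` set_pmf p) \<le> 1"
    using Min_in[OF fin] pmf_le_1[of p] by auto
  show "min_atom (Min (pmf p ` set_pmf p)) p"
    by (auto simp: min_atom_def)
qed

subsection \<open>Restrictions\<close>

text \<open>
  A restricted coordinate keeps its place but gets a point mass as its law, so restricted functions
  stay functions of all coordinates.
\<close>

lemma pmean_update:
  "i < length ps \<Longrightarrow> pmean ps F = mean (ps ! i) (\<lambda>a. pmean (ps[i := return_pmf a]) F)"
proof (induction ps arbitrary: i F)
  case (Cons p ps)
  show ?case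
  proof (cases i)
    case (Suc k)
    with Cons.prems show ?thesis
      by (simp add: Cons.IH[of k]) (rule mean_swap)
  qed simp
qed simp

lemma stab_zero [simp]: "stab ps t (\<lambda>_. 0) = 0"
  by (simp add: stab_eq)

text \<open>Revealing a coordinate removes its noise: with \<open>f (a # zs)\<close> split into
  average and deviation, the cross terms vanish in the mean over \<open>a\<close>.\<close>

lemma stab_update:
  "i < length ps \<Longrightarrow> mean (ps ! i) (\<lambda>a. stab (ps[i := return_pmf a]) t f) = stab ps (t(i := 1)) f"
proof (induction ps arbitrary: i t f)
  case (Cons p ps)
  show ?case
  proof (cases i)
    case 0
    let ?N = "noise ps (\<lambda>k. t (Suc k))"
    have "stab (return_pmf a # ps) t f =
        pmean ps (\<lambda>zs. (avg p f zs + dev p f a zs) * (?N (avg p f) zs + ?N (dev p f a) zs))" for a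
    proof -
      have "stab (return_pmf a # ps) t f = stab ps (\<lambda>k. t (Suc k)) (\<lambda>zs. f (a # zs))"
        by (simp add: avg_def[abs_def] dev_def[abs_def])
      also have "(\<lambda>zs. f (a # zs)) = (\<lambda>zs. avg p f zs + dev p f a zs)"
        by (simp add: dev_def)
      finally show ?thesis
        by (simp only: stab_eq noise_add)
    qed
    then have "mean p (\<lambda>a. stab (return_pmf a # ps) t f) = stab (p # ps) (t(0 := 1)) f"
      by (simp add: mean_pmean_orthogonal flip: stab_eq)
    then show ?thesis
      by (simp only: 0 nth_Cons_0 list_update.simps nat.case)
  next
    case (Suc k)
    with Cons.prems have "k < length ps"
      by simp
    note IH = Cons.IH[OF this]
    show ?thesis
      by (simp add: Suc mean_add mean_cmult mean_swap[of "ps ! k" p] IH)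
  qed
qed simp

text \<open>Revealing a coordinate with a point mass as its law changes nothing. Consequently an
  influential coordinate is never already restricted.\<close>

lemma influence_return:
  assumes "i < length ps" "ps ! i = return_pmf a"
  shows "influence ps t i f = 0"
proof -
  have "ps[i := return_pmf a] = ps"
    using assms by (metis list_update_id)
  then show ?thesis
    using stab_update[OF assms(1), of "t(i := 0)" f] assms(2) by (simp add: influence_def)
qed

definition restricted :: "'b pmf \<Rightarrow> nat \<Rightarrow> (nat \<rightharpoonup> 'b) \<Rightarrow> 'b pmf list" where
  "restricted P n R = map (\<lambda>i. case R i of None \<Rightarrow> P | Some a \<Rightarrow> return_pmf a) [0..<n]"

lemma length_restricted [simp]: "length (restricted P n R) = n"
  by (simp add: restricted_def)

lemma nth_restricted: "i < n \<Longrightarrow> restricted P n R ! i = (case R i of None \<Rightarrow> P | Some a \<Rightarrow> return_pmf a)"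
  by (simp add: restricted_def)

lemma restricted_upd: "restricted P n (R(i \<mapsto> a)) = (restricted P n R)[i := return_pmf a]"
  by (rule nth_equalityI) (auto simp: nth_restricted nth_list_update)

lemma restricted_empty: "restricted P n Map.empty = replicate n P"
  by (rule nth_equalityI) (auto simp: nth_restricted)

lemma set_restricted: "p \<in> set (restricted P n R) \<Longrightarrow> p = P \<or> (\<exists>a. p = return_pmf a)"
  by (auto simp: restricted_def split: option.splits)

lemma pmean_restricted:
  "pmean (restricted P n R) F =
    pmean (replicate n P) (\<lambda>xs. F (map (\<lambda>i. case R i of None \<Rightarrow> xs ! i | Some a \<Rightarrow> a) [0..<n]))"
proof (induction n arbitrary: F)
  case (Suc n)
  \<comment> \<open>The induction splits off the last coordinate, where \<open>[0..<Suc n]\<close>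
    grows; \<open>h\<close> ignores it.\<close>
  define h where "h xs = map (\<lambda>i. case R i of None \<Rightarrow> xs ! i | Some a \<Rightarrow> a) [0..<n]" for xs
  have h: "h (xs @ [x]) = h xs" if "length xs = n" for xs x
    using that by (auto simp: h_def nth_append intro!: map_cong split: option.splits)
  have "pmean (restricted P (Suc n) R) F =
      pmean (replicate n P) (\<lambda>xs. mean (case R n of None \<Rightarrow> P | Some a \<Rightarrow> return_pmf a) (\<lambda>x. F (h xs @ [x])))"
    by (simp add: restricted_def pmean_snoc) (simp add: Suc[unfolded restricted_def] h_def)
  also have "\<dots> = pmean (replicate n P) (\<lambda>xs. mean P (\<lambda>x. F (h (xs @ [x]) @ [case R n of None \<Rightarrow> x | Some a \<Rightarrow> a])))"
    by (intro pmean_cong_length) (auto simp: h split: option.splits)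
  also have "\<dots> = pmean (replicate n P) (\<lambda>xs. mean P (\<lambda>x. F (h (xs @ [x]) @ [case R n of None \<Rightarrow> (xs @ [x]) ! n | Some a \<Rightarrow> a])))"
    by (intro pmean_cong_length) (simp add: nth_append cong: option.case_cong)
  finally show ?case
    by (simp add: pmean_snoc h_def flip: replicate_append_same)
qed (simp add: restricted_def)

lemma stab_le_1: "(\<And>k. 0 \<le> t k \<and> t k \<le> 1) \<Longrightarrow> (\<And>xs. 0 \<le> f xs \<and> f xs \<le> 1) \<Longrightarrow> stab ps t f \<le> 1"
proof -
  assume t: "\<And>k. 0 \<le> t k \<and> t k \<le> 1" and f: "\<And>xs. 0 \<le> f xs \<and> f xs \<le> 1"
  have "stab ps t f \<le> stab ps (\<lambda>_. 1) f"
    using stab_mono[of t "\<lambda>_. 1"] t by auto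
  also have "\<dots> \<le> 1"
    unfolding stab_one using pmean_mono[of "\<lambda>xs. (f xs)\<^sup>2" "\<lambda>_. 1" ps] f by (simp add: power_le_one)
  finally show ?thesis .
qed

text \<open>
  The potential \<open>\<Sum>j. stab (f j)\<close> is at most \<open>CARD('l)\<close>, and revealing a coordinate of influence above \<open>\<tau>\<close>
  raises its mean by more than \<open>(1 - s) * \<tau>\<close>.
\<close>

lemma exists_regular_restriction:
  fixes P :: "('l::finite \<Rightarrow> 'a::finite) pmf"
  assumes P: "min_atom \<alpha> P" "0 < \<alpha>" "\<alpha> \<le> 1" and s: "0 \<le> s" "s < 1" and "0 < \<tau>"
    and k: "real CARD('l) < real k * ((1 - s) * \<tau>)"
    and f: "\<And>j xs. 0 \<le> f j xs \<and> f j xs \<le> (1::real)"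
  obtains R where "dom R \<subseteq> {..<n}" "ran R \<subseteq> set_pmf P" "card (dom R) \<le> k"
    "\<And>F. (\<And>xs. 0 \<le> F xs) \<Longrightarrow> \<alpha> ^ k * pmean (restricted P n R) F \<le> pmean (replicate n P) F"
    "\<And>j i. i < n \<Longrightarrow> influence (map (\<lambda>p. marginal p j) (restricted P n R)) (\<lambda>_. s) i (f j) \<le> \<tau>"
proof -
  define M where "M R j = map (\<lambda>p. marginal p j) (restricted P n R)" for R j
  define \<Psi> where "\<Psi> R = (\<Sum>j\<in>UNIV. stab (M R j) (\<lambda>_. s) (f j))" for R
  define good where "good R \<longleftrightarrow> (\<forall>j. \<forall>i<n. influence (M R j) (\<lambda>_. s) i (f j) \<le> \<tau>)" for R
  \<comment> \<open>Invariant after \<open>m\<close> rounds: either all influences are small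
    already, or the potential has grown by \<open>(1 - s) * \<tau>\<close> in each round.\<close>
  have "\<exists>R. dom R \<subseteq> {..<n} \<and> ran R \<subseteq> set_pmf P \<and> card (dom R) \<le> m \<and>
      (\<forall>F. (\<forall>xs. 0 \<le> F xs) \<longrightarrow> \<alpha> ^ m * pmean (restricted P n R) F \<le> pmean (replicate n P) F) \<and>
      (good R \<or> real m * ((1 - s) * \<tau>) \<le> \<Psi> R)" for m
  proof (induction m)
    case 0
    have "0 \<le> \<Psi> Map.empty"
      unfolding \<Psi>_def using s by (intro sum_nonneg stab_nonneg)
    then show ?case
      by (intro exI[of _ Map.empty]) (simp add: restricted_empty)
  next
    case (Suc m)
    then obtain R where R: "dom R \<subseteq> {..<n}" "ran R \<subseteq> set_pmf P" "card (dom R) \<le> m"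
      "\<And>F. (\<And>xs. 0 \<le> F xs) \<Longrightarrow> \<alpha> ^ m * pmean (restricted P n R) F \<le> pmean (replicate n P) F"
      "good R \<or> real m * ((1 - s) * \<tau>) \<le> \<Psi> R"
      by blast
    show ?case
    proof (cases "good R")
      case True
      have "\<alpha> ^ Suc m * pmean (restricted P n R) F \<le> pmean (replicate n P) F" if F: "\<forall>xs. 0 \<le> F xs" for F
      proof -
        have "\<alpha> * (\<alpha> ^ m * pmean (restricted P n R) F) \<le> 1 * (\<alpha> ^ m * pmean (restricted P n R) F)"
          using P F by (intro mult_right_mono) (auto intro!: mult_nonneg_nonneg pmean_nonneg)
        also have "\<dots> \<le> pmean (replicate n P) F"
          using R(4) F by simp
        finally show ?thesis
          by simp
      qed
      with True R show ?thesis
        by (intro exI[of _ R]) auto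
    next
      case False
      then obtain j i where i: "i < n" and inf: "\<tau> < influence (M R j) (\<lambda>_. s) i (f j)"
        by (auto simp: good_def not_le)
      have Ri: "R i = None"
      proof (rule ccontr)
        assume "R i \<noteq> None"
        then obtain a where "R i = Some a"
          by auto
        then have "M R j ! i = return_pmf (a j)"
          using i by (simp add: M_def nth_restricted marginal_def)
        then show False
          using influence_return[of i "M R j"] i inf \<open>0 < \<tau>\<close> by (simp add: M_def)
      qed
      have Mi: "M R j ! i = marginal P j" for j
        using i Ri by (simp add: M_def nth_restricted)
      have M_upd: "M (R(i \<mapsto> a)) j = (M R j)[i := return_pmf (a j)]" for a j
        by (simp add: M_def restricted_upd map_update marginal_def)
      have len: "i < length (M R j)" for j
        using i by (simp add: M_def)
      have "mean P (\<lambda>a. \<Psi> (R(i \<mapsto> a))) = (\<Sum>j\<in>UNIV. stab (M R j) ((\<lambda>_. s)(i := 1)) (f j))"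
        unfolding \<Psi>_def mean_sum
      proof (intro sum.cong refl)
        fix j
        show "mean P (\<lambda>a. stab (M (R(i \<mapsto> a)) j) (\<lambda>_. s) (f j)) = stab (M R j) ((\<lambda>_. s)(i := 1)) (f j)"
          using stab_update[OF len, of j "\<lambda>_. s" "f j"] unfolding M_upd Mi mean_marginal .
      qed
      also have "\<dots> = (\<Sum>j\<in>UNIV. stab (M R j) (\<lambda>_. s) (f j) + (1 - s) * influence (M R j) (\<lambda>_. s) i (f j))"
      proof (intro sum.cong refl)
        fix j
        have "(\<lambda>_. s)(i := s) = (\<lambda>_. s)"
          by auto
        then show "stab (M R j) ((\<lambda>_. s)(i := 1)) (f j) = stab (M R j) (\<lambda>_. s) (f j) + (1 - s) * influence (M R j) (\<lambda>_. s) i (f j)"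
          using stab_upd[of "M R j" "\<lambda>_. s" i s "f j"] stab_upd[of "M R j" "\<lambda>_. s" i 1 "f j"]
          by (simp add: algebra_simps)
      qed
      also have "\<dots> = \<Psi> R + (1 - s) * (\<Sum>j\<in>UNIV. influence (M R j) (\<lambda>_. s) i (f j))"
        by (simp add: \<Psi>_def sum.distrib sum_distrib_left)
      finally have mean_\<Psi>: "mean P (\<lambda>a. \<Psi> (R(i \<mapsto> a))) = \<Psi> R + (1 - s) * (\<Sum>j\<in>UNIV. influence (M R j) (\<lambda>_. s) i (f j))" .
      have inf_nn: "0 \<le> influence (M R j) (\<lambda>_. s) i (f j)" for j
        using influence_mono[of "\<lambda>_. s" "\<lambda>_. s"] s by auto
      have "\<tau> \<le> (\<Sum>j\<in>UNIV. influence (M R j) (\<lambda>_. s) i (f j))"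
        using member_le_sum[of j UNIV "\<lambda>j. influence (M R j) (\<lambda>_. s) i (f j)"] inf inf_nn by simp
      then have gain: "\<Psi> R + (1 - s) * \<tau> \<le> mean P (\<lambda>a. \<Psi> (R(i \<mapsto> a)))"
        unfolding mean_\<Psi> using s by simp
      \<comment> \<open>The value is a whole tuple from the support of \<open>P\<close>, so the
        coordinate is fixed in all the functions at once and consistently.\<close>
      obtain a where a: "a \<in> set_pmf P" "mean P (\<lambda>a. \<Psi> (R(i \<mapsto> a))) \<le> \<Psi> (R(i \<mapsto> a))"
        using mean_attained[of P "\<lambda>a. \<Psi> (R(i \<mapsto> a))"] by blast
      show ?thesis
      proof (intro exI[of _ "R(i \<mapsto> a)"] conjI allI impI)
        show "dom (R(i \<mapsto> a)) \<subseteq> {..<n}"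
          using R i by auto
        show "ran (R(i \<mapsto> a)) \<subseteq> set_pmf P"
          using R Ri a by auto
        have "finite (dom R)"
          using R(1) by (rule finite_subset) simp
        then show "card (dom (R(i \<mapsto> a))) \<le> Suc m"
          using R(3) by (simp add: card_insert_if)
        show "good (R(i \<mapsto> a)) \<or> real (Suc m) * ((1 - s) * \<tau>) \<le> \<Psi> (R(i \<mapsto> a))"
          using R(5) False gain a(2) by (simp add: distrib_right)
        fix F :: "('l \<Rightarrow> 'a) list \<Rightarrow> real" assume F: "\<forall>xs. 0 \<le> F xs"
        \<comment> \<open>Coordinate \<open>i\<close> takes the value \<open>a\<close> with
          probability at least \<open>\<alpha>\<close>; this is the price of one round.\<close>
        have "\<alpha> * pmean (restricted P n (R(i \<mapsto> a))) F \<le> pmf P a * pmean (restricted P n (R(i \<mapsto> a))) F"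
          using P a F unfolding min_atom_def by (intro mult_right_mono pmean_nonneg) auto
        also have "\<dots> \<le> mean P (\<lambda>a. pmean (restricted P n (R(i \<mapsto> a))) F)"
          using F by (intro mean_ge_atom pmean_nonneg) auto
        also have "\<dots> = pmean (restricted P n R) F"
          using pmean_update[of i "restricted P n R" F] i Ri by (simp add: restricted_upd nth_restricted)
        finally have "\<alpha> ^ m * (\<alpha> * pmean (restricted P n (R(i \<mapsto> a))) F) \<le> \<alpha> ^ m * pmean (restricted P n R) F"
          using P by (intro mult_left_mono) auto
        also have "\<dots> \<le> pmean (replicate n P) F"
          using R(4) F by simp
        finally show "\<alpha> ^ Suc m * pmean (restricted P n (R(i \<mapsto> a))) F \<le> pmean (replicate n P) F"
          by (simp add: mult_ac)
      qed
    qed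
  qed
  from this[of k] obtain R where R: "dom R \<subseteq> {..<n}" "ran R \<subseteq> set_pmf P" "card (dom R) \<le> k"
      "\<And>F. (\<And>xs. 0 \<le> F xs) \<Longrightarrow> \<alpha> ^ k * pmean (restricted P n R) F \<le> pmean (replicate n P) F"
      "good R \<or> real k * ((1 - s) * \<tau>) \<le> \<Psi> R"
    by blast
  \<comment> \<open>After \<open>k\<close> rounds the growth alternative would exceed this
    bound.\<close>
  have "\<Psi> R \<le> real CARD('l) * 1"
    unfolding \<Psi>_def using s f by (intro sum_bounded_above stab_le_1) auto
  with R(5) k have "good R"
    by auto
  then show ?thesis
    using that[OF R(1-4)] by (auto simp: good_def M_def)
qed

subsection \<open>The theorem\<close>

lemma expectation_iid_law:
  fixes P :: "('l::finite \<Rightarrow> 'a::finite) pmf"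
  shows "measure_pmf.expectation (iid_law n P) F =
    pmean (replicate n P) (\<lambda>xs. F (\<lambda>i. if i < n then xs ! i else undefined))"
proof (induction n arbitrary: F)
  case 0
  then show ?case
    by (simp add: iid_law_def)
next
  case (Suc n)
  have fin: "finite (set_pmf (iid_law n P))"
    unfolding iid_law_def by (subst set_Pi_pmf) auto
  have "iid_law (Suc n) P = P \<bind> (\<lambda>y. map_pmf (\<lambda>X. X(n := y)) (iid_law n P))"
    by (simp add: iid_law_def lessThan_Suc Pi_pmf_insert' map_pmf_def)
  then have "measure_pmf.expectation (iid_law (Suc n) P) F =
      mean P (\<lambda>y. measure_pmf.expectation (iid_law n P) (\<lambda>X. F (X(n := y))))"
    using fin by (simp add: pmf_expectation_bind[of UNIV] mean_def)
  also have "\<dots> = pmean (replicate n P) (\<lambda>xs. mean P (\<lambda>y. F ((\<lambda>i. if i < n then xs ! i else undefined)(n := y))))"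
    by (simp add: Suc.IH pmean_mean)
  also have "\<dots> = pmean (replicate n P) (\<lambda>xs. mean P (\<lambda>y. F (\<lambda>i. if i < Suc n then (xs @ [y]) ! i else undefined)))"
  proof (rule pmean_cong_length)
    fix xs :: "('l \<Rightarrow> 'a) list" assume "length xs = length (replicate n P)"
    then have "(\<lambda>i. if i < n then xs ! i else undefined)(n := y) =
        (\<lambda>i. if i < Suc n then (xs @ [y]) ! i else undefined)" for y
      by (auto simp: fun_eq_iff nth_append less_Suc_eq)
    then show "mean P (\<lambda>y. F ((\<lambda>i. if i < n then xs ! i else undefined)(n := y))) =
        mean P (\<lambda>y. F (\<lambda>i. if i < Suc n then (xs @ [y]) ! i else undefined))"
      by simp
  qed
  also have "\<dots> = pmean (replicate (Suc n) P) (\<lambda>xs. F (\<lambda>i. if i < Suc n then xs ! i else undefined))"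
    unfolding replicate_Suc replicate_append_same[symmetric] pmean_snoc ..
  finally show ?case .
qed

text \<open>The argument of \<open>f\<close> is extensional on \<open>{..<n}\<close> for lists of
  every length, so bounds on \<open>f\<close> transfer to all lists.\<close>

definition on_list :: "nat \<Rightarrow> ((nat \<Rightarrow> 'a) \<Rightarrow> real) \<Rightarrow> 'a list \<Rightarrow> real" where
  "on_list n f ys = f (\<lambda>i\<in>{..<n}. ys ! i)"

lemma on_list_marginal_seq:
  assumes "length xs = n"
  shows "f (marginal_seq n j (\<lambda>i. if i < n then xs ! i else undefined)) = on_list n f (map (\<lambda>x. x j) xs)"
  unfolding on_list_def marginal_seq_def using assms
  by (intro arg_cong[where f = f]) (auto simp: fun_eq_iff)

text \<open>A restriction \<open>R\<close> by tuples induces the restriction \<open>Rj\<close> by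
  their \<open>j\<close>-th entries, with the same domain and with values in the support of the
  marginal, so resilience applies to it.\<close>

lemma resilient_restricted_ge:
  fixes P :: "('l::finite \<Rightarrow> 'a::finite) pmf"
  assumes res: "resilient P n j \<epsilon> k f"
    and R: "dom R \<subseteq> {..<n}" "ran R \<subseteq> set_pmf P" "card (dom R) \<le> k"
  shows "(1 - \<epsilon>) * measure_pmf.expectation (iid_law n P) (\<lambda>X. f (marginal_seq n j X)) \<le>
    pmean (map (\<lambda>p. marginal p j) (restricted P n R)) (on_list n f)"
proof -
  define Rj where "Rj = (\<lambda>i. map_option (\<lambda>a. a j) (R i))"
  have dom: "dom Rj = dom R"
    by (auto simp: Rj_def)
  have "ran Rj \<subseteq> set_pmf (marginal P j)"
    using R(2) by (auto simp: Rj_def ran_def marginal_def)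
  then have "(1 - \<epsilon>) * measure_pmf.expectation (iid_law n P) (\<lambda>X. f (marginal_seq n j X)) \<le>
      measure_pmf.expectation (iid_law n P) (\<lambda>X. apply_restriction n Rj f (marginal_seq n j X))"
    using res R unfolding resilient_def Let_def dom[symmetric] by blast
  also have "\<dots> = pmean (replicate n P) (\<lambda>xs. on_list n f (map (\<lambda>x. x j)
      (map (\<lambda>i. case R i of None \<Rightarrow> xs ! i | Some a \<Rightarrow> a) [0..<n])))"
    unfolding expectation_iid_law
  proof (rule pmean_cong_length)
    fix xs :: "('l \<Rightarrow> 'a) list" assume "length xs = length (replicate n P)"
    then show "apply_restriction n Rj f (marginal_seq n j (\<lambda>i. if i < n then xs ! i else undefined)) =
        on_list n f (map (\<lambda>x. x j) (map (\<lambda>i. case R i of None \<Rightarrow> xs ! i | Some a \<Rightarrow> a) [0..<n]))"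
      unfolding apply_restriction_def on_list_def
      by (intro arg_cong[where f = f])
        (auto simp: fun_eq_iff Rj_def marginal_seq_def split: option.splits)
  qed
  also have "\<dots> = pmean (map (\<lambda>p. marginal p j) (restricted P n R)) (on_list n f)"
    by (simp add: pmean_marginal pmean_restricted)
  finally show ?thesis .
qed

theorem theorem7p1:
  fixes P :: "('l::finite \<Rightarrow> 'a::finite) pmf"
    and \<rho> \<epsilon> :: real
    and \<mu> :: "'l \<Rightarrow> real"
  assumes "CARD('l) \<ge> 2"
    and "max_correlation P \<le> ereal \<rho>"
    and "\<rho> < 1"
    and "0 \<le> \<epsilon>"
    and "\<epsilon> < 1"
    and "\<And>j. 0 < \<mu> j \<and> \<mu> j \<le> 1"
  shows "\<exists>(k::nat) (c::real). c > 0 \<and>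
    (\<forall>(n::nat) (f :: 'l \<Rightarrow> (nat \<Rightarrow> 'a) \<Rightarrow> real).
      (\<forall>j. \<forall>x \<in> {..<n} \<rightarrow>\<^sub>E UNIV. 0 \<le> f j x \<and> f j x \<le> 1) \<longrightarrow>
      (\<forall>j. measure_pmf.expectation (iid_law n P) (\<lambda>X. f j (marginal_seq n j X)) = \<mu> j) \<longrightarrow>
      (\<forall>j. resilient P n j \<epsilon> k (f j)) \<longrightarrow>
      measure_pmf.expectation (iid_law n P) (\<lambda>X. \<Prod>j\<in>UNIV. f j (marginal_seq n j X)) \<ge> c)"
proof -
  define L where "L = real CARD('l)"
  have L: "2 \<le> L"
    using assms(1) by (simp add: L_def)
  define c where "c = (max \<rho> 0)\<^sup>2"
  have c: "0 \<le> c" "c < 1"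
    using assms(3) by (auto simp: c_def abs_square_less_1)
  define \<delta> where "\<delta> = (1 - c) / L"
  have "0 < \<delta>"
    using c L by (simp add: \<delta>_def)
  obtain \<alpha> where \<alpha>: "0 < \<alpha>" "\<alpha> \<le> 1" "min_atom \<alpha> P"
    using min_atom_exists[of P] by blast
  obtain K0 :: nat where K0: "32 / \<delta> < real K0"
    using reals_Archimedean2 by blast
  define K where "K = K0 + 3"
  have K: "3 \<le> K" "32 \<le> real K * \<delta>"
    using K0 \<open>0 < \<delta>\<close> by (auto simp: K_def field_simps)
  \<comment> \<open>By resilience, a lower bound for the product of the \<open>K\<close>-th powers
    of the restricted means, independent of \<open>n\<close> and of the restriction.\<close>
  define b where "b = (\<Prod>j\<in>UNIV. ((1 - \<epsilon>) * \<mu> j) ^ K)"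
  have "0 < b"
    unfolding b_def using assms by (intro prod_pos) auto
  \<comment> \<open>Solved from the requirement that replacing all \<open>f j\<close> by their noisy
    versions cost at most \<open>b / 4\<close>.\<close>
  define w where "w = (b / (4 * L))\<^sup>2 * (1 - c)"
  have "0 < w"
    unfolding w_def using \<open>0 < b\<close> L c by simp
  define s where "s = max 0 (1 - w)"
  have s: "0 \<le> s" "s < 1" "1 - s \<le> w"
    using \<open>0 < w\<close> by (auto simp: s_def)
  have smooth: "L * sqrt (c * (1 - s) / (1 - c)) \<le> b / 4"
  proof -
    have "c * (1 - s) / (1 - c) \<le> 1 * w / (1 - c)"
      using c s by (intro divide_right_mono mult_mono) auto
    also have "\<dots> = (b / (4 * L))\<^sup>2"
      using c by (simp add: w_def)
    finally have "sqrt (c * (1 - s) / (1 - c)) \<le> b / (4 * L)"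
      using \<open>0 < b\<close> L by (intro real_le_lsqrt) auto
    then show ?thesis
      using L by (simp add: field_simps)
  qed
  define C where "C = (2 * real K * L) ^ 3 / \<alpha>"
  have "0 < C"
    unfolding C_def using K L \<alpha> by simp
  \<comment> \<open>The third moment bound is stated for the rate \<open>\<theta>\<^sup>2\<close>;
    it is used with \<open>\<theta> = sqrt s\<close>.\<close>
  have sqrt_s: "0 \<le> sqrt s" "sqrt s < 1" "(sqrt s)\<^sup>2 = s"
    using s by auto
  \<comment> \<open>The martingale error is \<open>C\<close> times a sum of \<open>L\<close> terms,
    so this bound per term keeps it below \<open>b / 4\<close>.\<close>
  have pos: "0 < b / (4 * L * C)"
    using \<open>0 < b\<close> \<open>0 < C\<close> L by simp
  obtain \<tau> where \<tau>: "0 < \<tau>" "\<And>(ps :: 'a pmf list) f.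
    \<forall>p\<in>set ps. min_atom \<alpha> p \<Longrightarrow> (\<And>xs. 0 \<le> f xs \<and> f xs \<le> 1) \<Longrightarrow>
    (\<And>i. i < length ps \<Longrightarrow> influence ps (\<lambda>_. s) i f \<le> \<tau>) \<Longrightarrow>
    mart3 ps (noise ps (\<lambda>_. s) f) \<le> b / (4 * L * C)"
    by (rule mart3_noise_le[OF \<alpha>(1) sqrt_s(1,2) pos, unfolded sqrt_s(3)]) (rule that; blast)
  obtain k :: nat where k: "L < real k * ((1 - s) * \<tau>)"
    using reals_Archimedean3[of "(1 - s) * \<tau>"] s \<tau>(1) by auto
  \<comment> \<open>The martingale and smoothing errors each take at most \<open>b / 4\<close> from
    \<open>b\<close>; the factor \<open>\<alpha> ^ k\<close> pays for the restriction.\<close>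
  have bound: "\<alpha> ^ k * (b / 2) \<le> measure_pmf.expectation (iid_law n P) (\<lambda>X. \<Prod>j\<in>UNIV. f j (marginal_seq n j X))"
    if range: "\<forall>j. \<forall>x \<in> {..<n} \<rightarrow>\<^sub>E UNIV. 0 \<le> f j x \<and> f j x \<le> 1"
      and means: "\<forall>j. measure_pmf.expectation (iid_law n P) (\<lambda>X. f j (marginal_seq n j X)) = \<mu> j"
      and res: "\<forall>j. resilient P n j \<epsilon> k (f j)"
    for n and f :: "'l \<Rightarrow> (nat \<Rightarrow> 'a) \<Rightarrow> real"
  proof -
    define h where "h j = on_list n (f j)" for j
    have h: "0 \<le> h j ys \<and> h j ys \<le> 1" for j ys
      unfolding h_def on_list_def using range by auto
    obtain R where R: "dom R \<subseteq> {..<n}" "ran R \<subseteq> set_pmf P" "card (dom R) \<le> k"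
      "\<And>F. (\<And>xs. 0 \<le> F xs) \<Longrightarrow> \<alpha> ^ k * pmean (restricted P n R) F \<le> pmean (replicate n P) F"
      "\<And>j i. i < n \<Longrightarrow> influence (map (\<lambda>p. marginal p j) (restricted P n R)) (\<lambda>_. s) i (h j) \<le> \<tau>"
      using exists_regular_restriction[OF \<alpha>(3,1,2) s(1,2) \<tau>(1) k[unfolded L_def], of h n] h by blast
    define ps where "ps = restricted P n R"
    define M where "M j = map (\<lambda>p. marginal p j) ps" for j
    define g where "g j = noise (M j) (\<lambda>_. s) (h j)" for j
    have P: "spread \<delta> p \<and> min_atom \<alpha> p \<and> (\<forall>j. contractive c j p)" if "p \<in> set ps" for p
      using set_restricted[of p P n R] that \<alpha> max_correlation_spread[OF assms(2)] max_correlation_contractive[OF assms(2)]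
      by (auto simp: ps_def \<delta>_def c_def L_def spread_return min_atom_return contractive_return)
    have g: "0 \<le> g j ys \<and> g j ys \<le> 1" if "length ys = length ps" for j ys
      unfolding g_def using noise_range[of "\<lambda>_. s" "h j" ys "M j"] s h that by (auto simp: M_def)
    have mean_ge: "(1 - \<epsilon>) * \<mu> j \<le> pmean (M j) (h j)" for j
      using resilient_restricted_ge[OF res[rule_format, of j] R(1-3)] means by (simp add: M_def ps_def h_def)
    have "b \<le> (\<Prod>j\<in>UNIV. pmean (M j) (g j) ^ K)"
      unfolding b_def g_def pmean_noise
      using mean_ge assms by (intro prod_mono) (auto intro!: power_mono mult_nonneg_nonneg simp: less_imp_le)
    moreover have "C * (\<Sum>j\<in>UNIV. mart3 (M j) (g j)) \<le> b / 4"
    proof -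
      have "mart3 (M j) (g j) \<le> b / (4 * L * C)" for j
        unfolding g_def
      proof (rule \<tau>(2))
        show "\<forall>p\<in>set (M j). min_atom \<alpha> p"
          using P by (auto simp: M_def min_atom_marginal)
        show "influence (M j) (\<lambda>_. s) i (h j) \<le> \<tau>" if "i < length (M j)" for i
          using R(5)[of i j] that by (simp add: M_def ps_def)
      qed (rule h)
      then have "(\<Sum>j\<in>UNIV. mart3 (M j) (g j)) \<le> L * (b / (4 * L * C))"
        unfolding L_def by (intro sum_bounded_above)
      then have "C * (\<Sum>j\<in>UNIV. mart3 (M j) (g j)) \<le> C * (L * (b / (4 * L * C)))"
        using \<open>0 < C\<close> by (intro mult_left_mono) auto
      also have "\<dots> = b / 4"
        using \<open>0 < C\<close> L by simp
      finally show ?thesis .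
    qed
    moreover have "(\<Prod>j\<in>UNIV. pmean (M j) (g j) ^ K) - C * (\<Sum>j\<in>UNIV. mart3 (M j) (g j)) \<le>
        pmean ps (\<lambda>xs. \<Prod>j\<in>UNIV. g j (map (\<lambda>x. x j) xs) ^ K)"
      unfolding M_def C_def L_def using P \<alpha>(1) K g by (intro pmean_prod_power_ge) auto
    moreover have "pmean ps (\<lambda>xs. \<Prod>j\<in>UNIV. g j (map (\<lambda>x. x j) xs) ^ K) \<le> pmean ps (\<lambda>xs. \<Prod>j\<in>UNIV. g j (map (\<lambda>x. x j) xs))"
    proof (intro pmean_mono_length prod_mono)
      fix xs :: "('l \<Rightarrow> 'a) list" and j assume "length xs = length ps"
      then have "0 \<le> g j (map (\<lambda>x. x j) xs) \<and> g j (map (\<lambda>x. x j) xs) \<le> 1"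
        by (intro g) simp
      then show "0 \<le> g j (map (\<lambda>x. x j) xs) ^ K \<and> g j (map (\<lambda>x. x j) xs) ^ K \<le> g j (map (\<lambda>x. x j) xs)"
        using power_decreasing[of 1 K "g j (map (\<lambda>x. x j) xs)"] K(1) by simp
    qed
    moreover have "\<bar>pmean ps (\<lambda>xs. \<Prod>j\<in>UNIV. h j (map (\<lambda>x. x j) xs)) - pmean ps (\<lambda>xs. \<Prod>j\<in>UNIV. g j (map (\<lambda>x. x j) xs))\<bar> \<le> b / 4"
      using pmean_prod_noise_close[of ps c s h] P c s h smooth by (simp add: g_def M_def L_def)
    ultimately have "b / 2 \<le> pmean ps (\<lambda>xs. \<Prod>j\<in>UNIV. h j (map (\<lambda>x. x j) xs))"
      by linarith
    then have "\<alpha> ^ k * (b / 2) \<le> \<alpha> ^ k * pmean ps (\<lambda>xs. \<Prod>j\<in>UNIV. h j (map (\<lambda>x. x j) xs))"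
      using \<alpha> by (intro mult_left_mono) auto
    also have "\<dots> \<le> pmean (replicate n P) (\<lambda>xs. \<Prod>j\<in>UNIV. h j (map (\<lambda>x. x j) xs))"
      unfolding ps_def using h by (intro R(4) prod_nonneg) auto
    also have "\<dots> = measure_pmf.expectation (iid_law n P) (\<lambda>X. \<Prod>j\<in>UNIV. f j (marginal_seq n j X))"
      unfolding expectation_iid_law h_def
      by (intro pmean_cong_length prod.cong refl on_list_marginal_seq[symmetric]) simp
    finally show ?thesis .
  qed
  have "0 < \<alpha> ^ k * (b / 2)"
    using \<alpha> \<open>0 < b\<close> by simp
  with bound show ?thesis
    by (intro exI[of _ k] exI[of _ "\<alpha> ^ k * (b / 2)"]) blast
qed

end
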